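(* Let $F\in L^2_{\mathbb{X}}$ have the infinite Hoeffding decomposition $F=\sum_{M\in\mathcal{P}_{fin}(\mathbb{N})}F_M$. Then, for any $M=\{i_1,\dotsc,i_p\}\in\mathcal{P}_{fin}(\mathbb{N})$ (with $p=|M|$) it holds that $$F_M=\mathbb{E}\bigl[D_{i_1}D_{i_2}\cdots D_{i_p}F\,\big|\,\mathcal{F}_M\bigr].$$ Thus, one has the explicit formulae $$F=\mathbb{E}[F]+\sum_{p=1}^\infty\ \sum_{1\leq i_1<i_2<\ldots<i_p<\infty}\mathbb{E}\bigl[D_{i_1}D_{i_2}\cdots D_{i_p}F\,\big|\,\mathcal{F}_{\{i_1,\dotsc,i_p\}}\bigr] =\mathbb{E}[F]+\sum_{p=1}^\infty\frac{1}{p!}\sum_{(i_1,\dotsc,i_p)\in\mathbb{N}^p_{\neq}}\mathbb{E}\bigl[D_{i_1}D_{i_2}\cdots D_{i_p}F\,\big|\,\mathcal{F}_{\{i_1,\dotsc,i_p\}}\bigr].$$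
   Context: $\mathbb{N}=\{1,2,\ldots\}$, $\mathcal{P}_{fin}(\mathbb{N})$ is the collection of finite subsets of $\mathbb{N}$, and $\mathbb{N}^p_{\neq}$ is the set of $p$-tuples of pairwise distinct natural numbers. Let $(E_n,\mathcal{B}_n,\mu_n)$, $n\in\mathbb{N}$, be arbitrary probability spaces, and let $\mathbb{X}=(X_n)_{n\in\mathbb{N}}$ be a sequence of independent random variables on a probability space $(\Omega,\mathcal{A},\mathbb{P})$, where $X_n$ takes values in $E_n$ and has distribution $\mu_n$. Let $\mathcal{F}=\sigma(\mathbb{X})$ and $L^2_{\mathbb{X}}=L^2(\Omega,\mathcal{F},\mathbb{P})$ (real-valued). For $M\subseteq\mathbb{N}$ let $\mathcal{F}_M=\sigma(X_j,j\in M)$ and for $k\in\mathbb{N}$ let $\mathcal{G}_k=\sigma(X_j,j\neq k)$. Infinite Hoeffding decomposition: for $F\in L^2_{\mathbb{X}}$ and $M\in\mathcal{P}_{fin}(\mathbb{N})$ put $F_M:=\sum_{L\subseteq M}(-1)^{|M|-|L|}\mathbb{E}[F\,|\,\mathcal{F}_L]$. Then $F=\sum_{M\in\mathcal{P}_{fin}(\mathbb{N})}F_M$ with unconditional convergence in $L^2(\mathbb{P})$ and pairwise orthogonal summands; $F_M$ is $\mathcal{F}_M$-measurable and $\mathbb{E}[F_M|\mathcal{F}_K]=0$ a.s. unless $M\subseteq K$. For $F\in L^2_{\mathbb{X}}$ and $k\in\mathbb{N}$, $D_kF:=F-\mathbb{E}[F\,|\,\mathcal{G}_k]$; the operators $D_k$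 commute. The series in the claim are understood in the $L^2(\mathbb{P})$-sense (the inner series over index tuples converging unconditionally in $L^2(\mathbb{P})$). *)

theory Defs
  imports "HOL-Probability.Probability"
begin

text \<open>
  The index set of the sequence is \<open>{1..} :: nat set\<close>. The measurable spaces \<open>E n\<close> may all be
  different; they only share a common ambient type \<open>'b\<close>. Index tuples are lists, and elements of
  \<open>L\<^sup>2\<close> are represented by functions, so equality in \<open>L\<^sup>2\<close> is almost sure equality.
\<close>

definition L2 :: "'a measure \<Rightarrow> ('a \<Rightarrow> real) set" where
  "L2 M = {f \<in> borel_measurable M. integrable M (\<lambda>x. (f x)\<^sup>2)}"

definition L2norm :: "'a measure \<Rightarrow> ('a \<Rightarrow> real) \<Rightarrow> real" where
  "L2norm M f = sqrt (\<integral>x. (f x)\<^sup>2 \<partial>M)"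

text \<open>The membership requirements in the next two definitions exclude the default value 0 of the
  Bochner integral at non-integrable functions.\<close>

definition L2_tendsto ::
  "'a measure \<Rightarrow> ('i \<Rightarrow> 'a \<Rightarrow> real) \<Rightarrow> ('a \<Rightarrow> real) \<Rightarrow> 'i filter \<Rightarrow> bool" where
  "L2_tendsto M u f \<FF> \<longleftrightarrow>
     f \<in> L2 M \<and> (\<forall>\<^sub>F i in \<FF>. u i \<in> L2 M) \<and>
     ((\<lambda>i. L2norm M (\<lambda>x. u i x - f x)) \<longlongrightarrow> 0) \<FF>"

text \<open>Unconditional convergence in \<open>L\<^sup>2\<close>, as the convergence of the net of all finite partial
  sums (the same convention as in \<open>has_sum\<close>).\<close>

definition L2_has_sum ::
  "'a measure \<Rightarrow> ('i \<Rightarrow> 'a \<Rightarrow> real) \<Rightarrow> 'i set \<Rightarrow> ('a \<Rightarrow> real) \<Rightarrow> bool" where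
  "L2_has_sum M f A S \<longleftrightarrow>
     (\<forall>i\<in>A. f i \<in> L2 M) \<and>
     L2_tendsto M (\<lambda>I x. \<Sum>i\<in>I. f i x) S (finite_subsets_at_top A)"

text \<open>\<open>sigma_rv P E X J\<close> is \<open>\<sigma>(X\<^sub>j, j \<in> J)\<close> on the underlying set of \<open>P\<close>; it is the trivial
  \<open>\<sigma>\<close>-algebra for \<open>J = {}\<close>. Only its space and its measurable sets matter.\<close>

definition sigma_rv ::
  "'a measure \<Rightarrow> (nat \<Rightarrow> 'b measure) \<Rightarrow> (nat \<Rightarrow> 'a \<Rightarrow> 'b) \<Rightarrow> nat set \<Rightarrow> 'a measure" where
  "sigma_rv P E X J =
     sigma (space P) (\<Union>j\<in>J. {X j -` B \<inter> space P | B. B \<in> sets (E j)})"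

definition L2_X ::
  "'a measure \<Rightarrow> (nat \<Rightarrow> 'b measure) \<Rightarrow> (nat \<Rightarrow> 'a \<Rightarrow> 'b) \<Rightarrow> ('a \<Rightarrow> real) set" where
  "L2_X P E X = L2 (restr_to_subalg P (sigma_rv P E X {1..}))"

definition hoeffding_comp ::
  "'a measure \<Rightarrow> (nat \<Rightarrow> 'b measure) \<Rightarrow> (nat \<Rightarrow> 'a \<Rightarrow> 'b) \<Rightarrow> ('a \<Rightarrow> real) \<Rightarrow> nat set \<Rightarrow> 'a \<Rightarrow> real"
where
  "hoeffding_comp P E X F M = (\<lambda>\<omega>. \<Sum>L\<in>Pow M.
     (-1) ^ (card M - card L) * real_cond_exp P (sigma_rv P E X L) F \<omega>)"

definition D_op ::
  "'a measure \<Rightarrow> (nat \<Rightarrow> 'b measure) \<Rightarrow> (nat \<Rightarrow> 'a \<Rightarrow> 'b) \<Rightarrow> nat \<Rightarrow> ('a \<Rightarrow> real) \<Rightarrow> 'a \<Rightarrow> real"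
where
  "D_op P E X k F = (\<lambda>\<omega>. F \<omega> - real_cond_exp P (sigma_rv P E X ({1..} - {k})) F \<omega>)"

text \<open>\<open>D_list P E X [i\<^sub>1, \<dots>, i\<^sub>p] F = D\<^sub>i\<^sub>1 (D\<^sub>i\<^sub>2 (\<dots> (D\<^sub>i\<^sub>p F)))\<close>\<close>

definition D_list ::
  "'a measure \<Rightarrow> (nat \<Rightarrow> 'b measure) \<Rightarrow> (nat \<Rightarrow> 'a \<Rightarrow> 'b) \<Rightarrow> nat list \<Rightarrow> ('a \<Rightarrow> real) \<Rightarrow> 'a \<Rightarrow> real"
where
  "D_list P E X js F = foldr (D_op P E X) js F"

definition increasing_tuples :: "nat \<Rightarrow> nat list set" where
  "increasing_tuples p = {js. length js = p \<and> set js \<subseteq> {1..} \<and> sorted_wrt (<) js}"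

definition distinct_tuples :: "nat \<Rightarrow> nat list set" where
  "distinct_tuples p = {js. length js = p \<and> set js \<subseteq> {1..} \<and> distinct js}"

end

theory Submission
  imports Defs
begin

text \<open>
  Write \<open>E\<^sub>K F\<close> for the conditional expectation of \<open>F\<close> given \<open>X\<^sub>j\<close>, \<open>j \<in> K\<close>. Independence
  yields \<open>E\<^sub>K E\<^sub>L = E\<^bsub>K \<inter> L\<^esub>\<close>. Expanding the product of the operators \<open>I - E\<^bsub>N - {k}\<^esub>\<close>, where
  \<open>N = {1..}\<close> and \<open>k \<in> M\<close>, gives the alternating sum of the \<open>E\<^bsub>N - L\<^esub> F\<close> over \<open>L \<subseteq> M\<close>, which \<open>E\<^sub>M\<close> maps to
  the alternating sum of the \<open>E\<^bsub>M - L\<^esub> F\<close>, that is, to \<open>F\<^sub>M\<close>. The components are pairwise orthogonal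
  and satisfy Bessel's inequality, so they are summable over every level \<open>card M = p\<close> by completeness of
  \<open>L\<^sup>2\<close>; Parseval's identity shows that the level sums add up to \<open>F\<close>. Summing over distinct tuples
  counts every \<open>F\<^sub>M\<close> exactly \<open>p!\<close> times.
\<close>

section \<open>Square-integrable functions\<close>

text \<open>The expansion of \<open>F\<close> into its components is not assumed but derived. A
  level \<open>card M = p\<close> is in general an infinite family, and no formula in terms of
  conditional expectations is at hand for its sum. That sum has to be produced as a limit, which is
  why completeness is needed. Elements of \<open>L2\<close> are functions, so most identities hold
  only almost everywhere; they are carried through inner products, which do not see null sets.
  Convergence is thereby reduced to real series of squared norms. Ordered tuples raise a further
  difficulty: all \<open>p!\<close> orderings of \<open>M\<close> carry the same component, so the
  family is no longer orthogonal, and a finite partial sum may contain only some of the orderings.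
  This is the origin of the constant \<open>c\<close> and of the inequality in
  \<open>L2_has_sumI\<close>. The expansion of the iterated differences depends only on the set of
  indices, so every ordering of \<open>M\<close> gives the same function almost everywhere.\<close>

definition L2_inner :: "'a measure \<Rightarrow> ('a \<Rightarrow> real) \<Rightarrow> ('a \<Rightarrow> real) \<Rightarrow> real" where
  "L2_inner M f g = (\<integral>x. f x * g x \<partial>M)"

lemma L2_measurable: "f \<in> L2 M \<Longrightarrow> f \<in> borel_measurable M"
  by (simp add: L2_def)

lemma L2_mult_integrable:
  assumes "f \<in> L2 M" "g \<in> L2 M"
  shows "integrable M (\<lambda>x. f x * g x)"
proof (rule Bochner_Integration.integrable_bound)
  show "integrable M (\<lambda>x. (f x)\<^sup>2 + (g x)\<^sup>2)" "(\<lambda>x. f x * g x) \<in> borel_measurable M"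
    using assms by (auto simp: L2_def)
  have "norm (a * b) \<le> norm (a\<^sup>2 + b\<^sup>2)" for a b :: real
  proof -
    have "2 * \<bar>a\<bar> * \<bar>b\<bar> \<le> \<bar>a\<bar>\<^sup>2 + \<bar>b\<bar>\<^sup>2" by (rule sum_squares_bound)
    moreover have "0 \<le> \<bar>a\<bar> * \<bar>b\<bar>" by simp
    ultimately have "\<bar>a\<bar> * \<bar>b\<bar> \<le> a\<^sup>2 + b\<^sup>2"
      by (simp only: power2_abs mult.assoc)
    then show ?thesis by (simp add: abs_mult)
  qed
  then show "AE x in M. norm (f x * g x) \<le> norm ((f x)\<^sup>2 + (g x)\<^sup>2)" by simp
qed

lemma L2_add:
  assumes "f \<in> L2 M" "g \<in> L2 M"
  shows "(\<lambda>x. f x + g x) \<in> L2 M"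
  using assms L2_mult_integrable[OF assms]
  by (auto simp: L2_def power2_sum mult.assoc intro!: Bochner_Integration.integrable_add)

lemma L2_cmult: "f \<in> L2 M \<Longrightarrow> (\<lambda>x. c * f x) \<in> L2 M"
  by (auto simp: L2_def power_mult_distrib)

lemma L2_diff:
  assumes "f \<in> L2 M" "g \<in> L2 M"
  shows "(\<lambda>x. f x - g x) \<in> L2 M"
  using L2_add[OF assms(1) L2_cmult[OF assms(2), of "-1"]] by simp

lemma L2_zero: "(\<lambda>x. 0) \<in> L2 M"
  by (simp add: L2_def)

lemma L2_sum: "(\<And>i. i \<in> I \<Longrightarrow> f i \<in> L2 M) \<Longrightarrow> (\<lambda>x. \<Sum>i\<in>I. f i x) \<in> L2 M"
  by (induction I rule: infinite_finite_induct) (auto intro: L2_zero L2_add)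

lemma (in finite_measure) L2_indicator:
  assumes "A \<in> sets M"
  shows "indicat_real A \<in> L2 M"
proof -
  have "(\<lambda>x. (indicat_real A x)\<^sup>2) = indicat_real A"
    by (auto simp: indicator_def)
  then show ?thesis
    using assms by (auto simp: L2_def less_top[symmetric] intro!: integrable_real_indicator)
qed

lemma L2_cong_AE:
  assumes "f \<in> L2 M" "g \<in> borel_measurable M" "AE x in M. f x = g x"
  shows "g \<in> L2 M"
proof -
  have "integrable M (\<lambda>x. (f x)\<^sup>2) \<longleftrightarrow> integrable M (\<lambda>x. (g x)\<^sup>2)"
    using assms by (intro integrable_cong_AE) (auto simp: L2_def)
  then show ?thesis using assms by (simp add: L2_def)
qed

lemma L2_inner_commute: "L2_inner M f g = L2_inner M g f"
  by (simp add: L2_inner_def mult.commute)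

lemma L2_inner_cong_AE:
  assumes "AE x in M. f x = f' x" "AE x in M. g x = g' x"
    and "f \<in> borel_measurable M" "f' \<in> borel_measurable M"
        "g \<in> borel_measurable M" "g' \<in> borel_measurable M"
  shows "L2_inner M f g = L2_inner M f' g'"
  unfolding L2_inner_def by (rule integral_cong_AE) (use assms in auto)

lemma L2_inner_diff_left:
  assumes "f \<in> L2 M" "g \<in> L2 M" "h \<in> L2 M"
  shows "L2_inner M (\<lambda>x. f x - g x) h = L2_inner M f h - L2_inner M g h"
  using assms by (simp add: L2_inner_def left_diff_distrib L2_mult_integrable)

lemma L2_inner_cmult_left: "L2_inner M (\<lambda>x. c * f x) h = c * L2_inner M f h"
  by (simp add: L2_inner_def mult.assoc)

lemma L2_inner_sum_left:
  assumes "\<And>i. i \<in> I \<Longrightarrow> f i \<in> L2 M" "h \<in> L2 M"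
  shows "L2_inner M (\<lambda>x. \<Sum>i\<in>I. f i x) h = (\<Sum>i\<in>I. L2_inner M (f i) h)"
  using assms by (simp add: L2_inner_def sum_distrib_right L2_mult_integrable)

lemma L2_inner_sum_right:
  assumes "\<And>i. i \<in> I \<Longrightarrow> f i \<in> L2 M" "h \<in> L2 M"
  shows "L2_inner M h (\<lambda>x. \<Sum>i\<in>I. f i x) = (\<Sum>i\<in>I. L2_inner M h (f i))"
  using L2_inner_sum_left[OF assms] by (simp add: L2_inner_commute)

lemma L2_inner_self_nonneg: "0 \<le> L2_inner M f f"
  by (simp add: L2_inner_def)

lemma L2norm_nonneg: "0 \<le> L2norm M f"
  by (simp add: L2norm_def)

lemma L2norm_power2: "(L2norm M f)\<^sup>2 = L2_inner M f f"
  by (simp add: L2norm_def L2_inner_def power2_eq_square)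

lemma L2norm_eq_sqrt: "L2norm M f = sqrt (L2_inner M f f)"
  by (simp add: L2norm_def L2_inner_def power2_eq_square)

lemma L2norm_minus_commute: "L2norm M (\<lambda>x. f x - g x) = L2norm M (\<lambda>x. g x - f x)"
  by (simp add: L2norm_def power2_commute)

lemma L2_inner_diff_self:
  assumes "f \<in> L2 M" "g \<in> L2 M"
  shows "L2_inner M (\<lambda>x. f x - g x) (\<lambda>x. f x - g x) =
    L2_inner M f f - 2 * L2_inner M f g + L2_inner M g g"
proof -
  have "L2_inner M (\<lambda>x. f x - g x) (\<lambda>x. f x - g x) =
     L2_inner M f (\<lambda>x. f x - g x) - L2_inner M g (\<lambda>x. f x - g x)"
    using assms by (intro L2_inner_diff_left L2_diff)
  moreover have "L2_inner M h (\<lambda>x. f x - g x) = L2_inner M f h - L2_inner M g h"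
    if "h \<in> L2 M" for h
    using assms that by (simp add: L2_inner_commute[of M h] L2_inner_diff_left)
  ultimately show ?thesis
    using assms by (simp add: L2_inner_commute[of M g f])
qed

lemma L2_Cauchy_Schwarz:
  assumes f: "f \<in> L2 M" and g: "g \<in> L2 M"
  shows "\<bar>L2_inner M f g\<bar> \<le> L2norm M f * L2norm M g"
proof -
  define a b c where "a = L2_inner M f f" and "b = L2_inner M f g" and "c = L2_inner M g g"
  have pos: "0 \<le> a - 2 * t * b + t\<^sup>2 * c" for t
  proof -
    have "0 \<le> L2_inner M (\<lambda>x. f x - t * g x) (\<lambda>x. f x - t * g x)"
      by (rule L2_inner_self_nonneg)
    also have "\<dots> = a - 2 * L2_inner M f (\<lambda>x. t * g x) + L2_inner M (\<lambda>x. t * g x) (\<lambda>x. t * g x)"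
      unfolding a_def by (intro L2_inner_diff_self f L2_cmult g)
    also have "L2_inner M f (\<lambda>x. t * g x) = t * b"
      by (simp add: L2_inner_commute[of M f] L2_inner_cmult_left b_def)
    also have "L2_inner M (\<lambda>x. t * g x) (\<lambda>x. t * g x) = t\<^sup>2 * c"
      by (simp add: L2_inner_cmult_left L2_inner_commute[of M g "\<lambda>x. t * g x"] c_def power2_eq_square)
    finally show ?thesis by simp
  qed
  have c: "0 \<le> c" by (simp add: c_def L2_inner_self_nonneg)
  have "b\<^sup>2 \<le> a * c"
  proof (cases "c = 0")
    case True
    have "b = 0"
    proof (rule ccontr)
      assume "b \<noteq> 0"
      \<comment> \<open>For \<open>c = 0\<close> the quadratic is affine in \<open>t\<close>; this
        \<open>t\<close> gives it the value -1.\<close>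
      with pos[of "(a + 1) / (2 * b)"] True show False by simp
    qed
    with True show ?thesis by simp
  next
    case False
    with c have "0 < c" by simp
    \<comment> \<open>The minimiser \<open>t = b / c\<close> of the quadratic gives the sharpest
      bound.\<close>
    moreover have "0 \<le> a - b\<^sup>2 / c"
      using pos[of "b / c"] False by (simp add: power2_eq_square)
    ultimately show ?thesis by (simp add: field_simps)
  qed
  then have "sqrt (b\<^sup>2) \<le> sqrt (a * c)" by (rule real_sqrt_le_mono)
  then show ?thesis
    by (simp add: real_sqrt_mult L2norm_eq_sqrt a_def b_def c_def)
qed

lemma (in finite_measure) L2_integrable:
  assumes "f \<in> L2 M"
  shows "integrable M f"
proof -
  have "(\<lambda>x. 1) \<in> L2 M" by (simp add: L2_def)
  from L2_mult_integrable[OF assms this] show ?thesis by simp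
qed

lemma (in prob_space) L1_le_L2norm:
  assumes "f \<in> L2 M"
  shows "(\<integral>x. \<bar>f x\<bar> \<partial>M) \<le> L2norm M f"
proof -
  have 1: "(\<lambda>x. 1) \<in> L2 M" by (simp add: L2_def)
  have 2: "(\<lambda>x. \<bar>f x\<bar>) \<in> L2 M" using assms by (auto simp: L2_def)
  have "L2norm M (\<lambda>x. 1) = 1" by (simp add: L2norm_def prob_space)
  moreover have "L2norm M (\<lambda>x. \<bar>f x\<bar>) = L2norm M f" by (simp add: L2norm_def)
  ultimately show ?thesis
    using L2_Cauchy_Schwarz[OF 2 1] by (simp add: L2_inner_def)
qed

text \<open>Fatou's lemma for the squares. The bound is asked for only eventually, so that it can be
  applied to tails of Cauchy sequences.\<close>

lemma L2_Fatou:
  assumes u: "\<And>k. u k \<in> L2 M" and S: "S \<in> borel_measurable M"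
    and lim: "AE x in M. (\<lambda>k. u k x) \<longlonglongrightarrow> S x"
    and bound: "\<forall>\<^sub>F k in sequentially. L2norm M (u k) \<le> C"
  shows "S \<in> L2 M" "L2norm M S \<le> C"
proof -
  have [measurable]: "u k \<in> borel_measurable M" for k using u by (rule L2_measurable)
  note S[measurable]
  obtain k where "L2norm M (u k) \<le> C"
    using bound by (metis eventually_at_top_linorder order_refl)
  then have C: "0 \<le> C" using L2norm_nonneg[of M "u k"] by linarith
  have "(\<integral>\<^sup>+x. ennreal ((S x)\<^sup>2) \<partial>M) = (\<integral>\<^sup>+x. liminf (\<lambda>k. ennreal ((u k x)\<^sup>2)) \<partial>M)"
  proof (rule nn_integral_cong_AE)
    show "AE x in M. ennreal ((S x)\<^sup>2) = liminf (\<lambda>k. ennreal ((u k x)\<^sup>2))"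
      using lim
    proof eventually_elim
      case (elim x)
      then have "(\<lambda>k. ennreal ((u k x)\<^sup>2)) \<longlonglongrightarrow> ennreal ((S x)\<^sup>2)"
        by (intro tendsto_ennrealI tendsto_power)
      from lim_imp_Liminf[OF _ this] show ?case by simp
    qed
  qed
  also have "\<dots> \<le> liminf (\<lambda>k. \<integral>\<^sup>+x. ennreal ((u k x)\<^sup>2) \<partial>M)"
    by (rule nn_integral_liminf) simp
  also have "\<dots> \<le> limsup (\<lambda>k. \<integral>\<^sup>+x. ennreal ((u k x)\<^sup>2) \<partial>M)"
    by (rule Liminf_le_Limsup) simp
  also have "\<dots> \<le> ennreal (C\<^sup>2)"
  proof (rule Limsup_bounded)
    show "\<forall>\<^sub>F k in sequentially. (\<integral>\<^sup>+x. ennreal ((u k x)\<^sup>2) \<partial>M) \<le> ennreal (C\<^sup>2)"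
      using bound
    proof eventually_elim
      case (elim k)
      have "(\<integral>\<^sup>+x. ennreal ((u k x)\<^sup>2) \<partial>M) = ennreal ((L2norm M (u k))\<^sup>2)"
        using u[of k] by (simp add: L2_def nn_integral_eq_integral L2norm_def)
      also have "\<dots> \<le> ennreal (C\<^sup>2)"
        using elim by (intro ennreal_leI power_mono L2norm_nonneg)
      finally show ?case .
    qed
  qed
  finally have le: "(\<integral>\<^sup>+x. ennreal ((S x)\<^sup>2) \<partial>M) \<le> ennreal (C\<^sup>2)" .
  have int: "integrable M (\<lambda>x. (S x)\<^sup>2)"
  proof (rule integrableI_nonneg)
    show "(\<integral>\<^sup>+x. ennreal ((S x)\<^sup>2) \<partial>M) < \<infinity>"
      using le by (rule order.strict_trans1) simp
  qed auto
  then show "S \<in> L2 M" by (simp add: L2_def)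
  have "ennreal (\<integral>x. (S x)\<^sup>2 \<partial>M) \<le> ennreal (C\<^sup>2)"
    using le nn_integral_eq_integral[OF int] by simp
  then have "(L2norm M S)\<^sup>2 \<le> C\<^sup>2"
    by (simp add: L2norm_def)
  then show "L2norm M S \<le> C" using C by (rule power2_le_imp_le)
qed

text \<open>Riesz-Fischer: along a subsequence with geometrically small increments the increments
  are summable almost everywhere, because their \<open>L1\<close> norms are bounded by their
  \<open>L2\<close> norms. \<open>L2_Fatou\<close> then turns the Cauchy bounds into bounds for the
  distance to the pointwise limit.\<close>

lemma (in prob_space) L2_complete:
  assumes u: "\<And>n. u n \<in> L2 M"
    and Cauchy: "\<And>e. 0 < e \<Longrightarrow> \<exists>N. \<forall>m\<ge>N. \<forall>n\<ge>N. L2norm M (\<lambda>x. u m x - u n x) \<le> e"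
  shows "\<exists>S\<in>L2 M. (\<lambda>n. L2norm M (\<lambda>x. u n x - S x)) \<longlonglongrightarrow> 0"
proof -
  have [measurable]: "u n \<in> borel_measurable M" for n using u by (rule L2_measurable)
  have "\<exists>N. \<forall>k. \<forall>m\<ge>N k. \<forall>n\<ge>N k. L2norm M (\<lambda>x. u m x - u n x) \<le> (1/2)^k"
    using Cauchy by (intro choice allI) simp
  then obtain N where N: "\<And>k m n. N k \<le> m \<Longrightarrow> N k \<le> n \<Longrightarrow> L2norm M (\<lambda>x. u m x - u n x) \<le> (1/2)^k"
    by blast
  \<comment> \<open>The sum makes \<open>r\<close> monotone and at least \<open>N k\<close>; the
    summand \<open>k\<close> makes it unbounded even if all \<open>N i\<close> vanish.\<close>
  define r where "r k = k + (\<Sum>i\<le>k. N i)" for k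
  have Nr: "N k \<le> r k" for k
    by (auto simp: r_def intro: trans_le_add2 member_le_sum)
  have r_Suc: "r k \<le> r (Suc k)" for k by (simp add: r_def)
  define d where "d k x = \<bar>u (r (Suc k)) x - u (r k) x\<bar>" for k x
  have [measurable]: "d k \<in> borel_measurable M" for k unfolding d_def by measurable
  have d_le: "(\<integral>\<^sup>+x. ennreal (d k x) \<partial>M) \<le> ennreal ((1/2)^k)" for k
  proof -
    have L: "(\<lambda>x. u (r (Suc k)) x - u (r k) x) \<in> L2 M" by (intro L2_diff u)
    have "(\<integral>\<^sup>+x. ennreal (d k x) \<partial>M) = ennreal (\<integral>x. d k x \<partial>M)"
      using L2_integrable[OF L] unfolding d_def by (intro nn_integral_eq_integral) auto
    also have "\<dots> \<le> ennreal ((1/2)^k)"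
      unfolding d_def using Nr[of k] r_Suc[of k]
      by (intro ennreal_leI order_trans[OF L1_le_L2norm[OF L]] N) auto
    finally show ?thesis .
  qed
  have "(\<integral>\<^sup>+x. (\<Sum>k. ennreal (d k x)) \<partial>M) = (\<Sum>k. \<integral>\<^sup>+x. ennreal (d k x) \<partial>M)"
    by (intro nn_integral_suminf) simp
  also have "\<dots> \<le> (\<Sum>k. ennreal ((1/2)^k))"
    by (intro suminf_le d_le) auto
  also have "\<dots> = ennreal (\<Sum>k. (1/2)^k)"
    by (intro suminf_ennreal2) auto
  finally have "(\<integral>\<^sup>+x. (\<Sum>k. ennreal (d k x)) \<partial>M) < \<infinity>"
    by (simp add: order.strict_trans1)
  then have "AE x in M. (\<Sum>k. ennreal (d k x)) \<noteq> \<infinity>"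
    by (intro nn_integral_PInf_AE) auto
  then have conv: "AE x in M. convergent (\<lambda>k. u (r k) x)"
  proof eventually_elim
    case (elim x)
    then have "summable (\<lambda>k. d k x)"
      by (intro summable_suminf_not_top) (auto simp: d_def)
    then have "summable (\<lambda>k. u (r (Suc k)) x - u (r k) x)"
      unfolding d_def by (rule summable_rabs_cancel)
    then have "convergent (\<lambda>n. (\<Sum>k<n. u (r (Suc k)) x - u (r k) x) + u (r 0) x)"
      by (intro convergent_add convergent_const) (simp add: summable_iff_convergent)
    then show ?case by (simp add: sum_lessThan_telescope[of "\<lambda>k. u (r k) x"])
  qed
  define S where "S x = lim (\<lambda>k. u (r k) x)" for x
  have [measurable]: "S \<in> borel_measurable M" unfolding S_def by measurable
  have lim: "AE x in M. (\<lambda>k. u (r k) x) \<longlonglongrightarrow> S x"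
    using conv by eventually_elim (simp add: S_def convergent_LIMSEQ_iff)
  \<comment> \<open>With \<open>n\<close> fixed, the other index runs to infinity along
    \<open>r\<close>. The result holds for every late \<open>n\<close>, so the whole sequence
    converges and not only the subsequence.\<close>
  have *: "(\<lambda>x. S x - u n x) \<in> L2 M \<and> L2norm M (\<lambda>x. S x - u n x) \<le> e"
    if "\<forall>m\<ge>K. \<forall>n\<ge>K. L2norm M (\<lambda>x. u m x - u n x) \<le> e" "n \<ge> K" for n K e
  proof -
    have "AE x in M. (\<lambda>k. u (r k) x - u n x) \<longlonglongrightarrow> S x - u n x"
      using lim by eventually_elim (intro tendsto_intros)
    moreover have "\<forall>\<^sub>F k in sequentially. L2norm M (\<lambda>x. u (r k) x - u n x) \<le> e"
      using eventually_ge_at_top[of K]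
    proof eventually_elim
      case (elim k)
      then have "K \<le> r k" by (simp add: r_def)
      with that show ?case by blast
    qed
    moreover have "(\<lambda>x. u (r k) x - u n x) \<in> L2 M" for k by (intro L2_diff u)
    ultimately show ?thesis
      using L2_Fatou[of "\<lambda>k x. u (r k) x - u n x" M "\<lambda>x. S x - u n x" e] by simp
  qed
  have "S \<in> L2 M"
  proof -
    obtain K where K: "\<forall>m\<ge>K. \<forall>n\<ge>K. L2norm M (\<lambda>x. u m x - u n x) \<le> 1"
      using Cauchy[of 1] by auto
    from *[OF K order_refl] have "(\<lambda>x. S x - u K x) \<in> L2 M" ..
    from L2_add[OF this u[of K]] show ?thesis by simp
  qed
  moreover have "(\<lambda>n. L2norm M (\<lambda>x. u n x - S x)) \<longlonglongrightarrow> 0"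
  proof (rule LIMSEQ_I)
    fix e :: real assume "0 < e"
    then obtain K where K: "\<forall>m\<ge>K. \<forall>n\<ge>K. L2norm M (\<lambda>x. u m x - u n x) \<le> e / 2"
      using Cauchy[of "e / 2"] by auto
    have "norm (L2norm M (\<lambda>x. u n x - S x) - 0) < e" if "n \<ge> K" for n
      using *[OF K that] \<open>0 < e\<close> L2norm_nonneg[of M "\<lambda>x. S x - u n x"]
      by (simp add: L2norm_minus_commute[of M "u n"])
    then show "\<exists>no. \<forall>n\<ge>no. norm (L2norm M (\<lambda>x. u n x - S x) - 0) < e" by blast
  qed
  ultimately show ?thesis by blast
qed

section \<open>Sums of square-integrable functions\<close>

lemma L2_tendsto_imp_inner_tendsto:
  assumes "L2_tendsto M u f \<FF>" "g \<in> L2 M"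
  shows "((\<lambda>i. L2_inner M (u i) g) \<longlongrightarrow> L2_inner M f g) \<FF>"
proof -
  have f: "f \<in> L2 M" and u: "\<forall>\<^sub>F i in \<FF>. u i \<in> L2 M"
    and lim: "((\<lambda>i. L2norm M (\<lambda>x. u i x - f x)) \<longlongrightarrow> 0) \<FF>"
    using assms(1) by (auto simp: L2_tendsto_def)
  have "((\<lambda>i. L2_inner M (u i) g - L2_inner M f g) \<longlongrightarrow> 0) \<FF>"
  proof (rule Lim_null_comparison)
    show "((\<lambda>i. L2norm M (\<lambda>x. u i x - f x) * L2norm M g) \<longlongrightarrow> 0) \<FF>"
      using tendsto_mult_right[OF lim, of "L2norm M g"] by simp
    show "\<forall>\<^sub>F i in \<FF>. norm (L2_inner M (u i) g - L2_inner M f g)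
            \<le> L2norm M (\<lambda>x. u i x - f x) * L2norm M g"
      using u
    proof eventually_elim
      case (elim i)
      have "L2_inner M (u i) g - L2_inner M f g = L2_inner M (\<lambda>x. u i x - f x) g"
        using elim f assms(2) by (simp add: L2_inner_diff_left)
      then show ?case
        using L2_Cauchy_Schwarz[OF L2_diff[OF elim f] assms(2)] by simp
    qed
  qed
  then show ?thesis by (rule LIM_zero_cancel)
qed

text \<open>Testing against a fixed \<open>g\<close> turns an \<open>L2\<close> sum into an
  unconditional sum of reals, where limits are unique and terms can be regrouped.\<close>

lemma L2_has_sum_imp_inner_has_sum:
  assumes "L2_has_sum M f A S" "g \<in> L2 M"
  shows "((\<lambda>i. L2_inner M (f i) g) has_sum L2_inner M S g) A"
proof -
  have "((\<lambda>I. L2_inner M (\<lambda>x. \<Sum>i\<in>I. f i x) g) \<longlongrightarrow> L2_inner M S g) (finite_subsets_at_top A)"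
    using assms by (intro L2_tendsto_imp_inner_tendsto) (auto simp: L2_has_sum_def)
  moreover have "\<forall>\<^sub>F I in finite_subsets_at_top A.
      L2_inner M (\<lambda>x. \<Sum>i\<in>I. f i x) g = (\<Sum>i\<in>I. L2_inner M (f i) g)"
    by (rule eventually_finite_subsets_at_top_weakI)
       (use assms in \<open>auto simp: L2_has_sum_def intro!: L2_inner_sum_left\<close>)
  ultimately show ?thesis
    unfolding has_sum_def using tendsto_cong by fastforce
qed

lemma L2norm_tendsto_zeroI:
  assumes "((\<lambda>i. L2_inner M (\<lambda>x. u i x - f x) (\<lambda>x. u i x - f x)) \<longlongrightarrow> 0) \<FF>"
  shows "((\<lambda>i. L2norm M (\<lambda>x. u i x - f x)) \<longlongrightarrow> 0) \<FF>"
  using tendsto_real_sqrt[OF assms] by (simp add: L2norm_eq_sqrt)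

text \<open>For an orthogonal family the hypotheses hold with \<open>c = 1\<close>; the general case covers
  families in which every member of an orthogonal family is repeated \<open>c\<close> times.\<close>

lemma L2_has_sumI:
  assumes g: "\<And>i. i \<in> A \<Longrightarrow> g i \<in> L2 M" and S: "S \<in> L2 M"
    and inner: "\<And>i. i \<in> A \<Longrightarrow> L2_inner M S (g i) = c * L2_inner M (g i) (g i)"
    and bound: "\<And>I. finite I \<Longrightarrow> I \<subseteq> A \<Longrightarrow>
      (\<Sum>i\<in>I. \<Sum>j\<in>I. L2_inner M (g i) (g j)) \<le> c * (\<Sum>i\<in>I. L2_inner M (g i) (g i))"
    and norm: "((\<lambda>i. c * L2_inner M (g i) (g i)) has_sum L2_inner M S S) A"
  shows "L2_has_sum M g A S"
proof -
  have "((\<lambda>I. L2_inner M S S - (\<Sum>i\<in>I. c * L2_inner M (g i) (g i))) \<longlongrightarrow>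
      L2_inner M S S - L2_inner M S S) (finite_subsets_at_top A)"
    using norm unfolding has_sum_def by (intro tendsto_intros)
  then have lim: "((\<lambda>I. L2_inner M S S - c * (\<Sum>i\<in>I. L2_inner M (g i) (g i))) \<longlongrightarrow> 0)
      (finite_subsets_at_top A)"
    by (simp add: sum_distrib_left)
  let ?s = "\<lambda>I x. \<Sum>i\<in>I. g i x"
  have "((\<lambda>I. L2_inner M (\<lambda>x. ?s I x - S x) (\<lambda>x. ?s I x - S x)) \<longlongrightarrow> 0) (finite_subsets_at_top A)"
  proof (rule Lim_null_comparison[OF _ lim], rule eventually_finite_subsets_at_top_weakI)
    fix I assume I: "finite I" "I \<subseteq> A"
    have gI: "g i \<in> L2 M" if "i \<in> I" for i using that I g by blast
    have sI: "?s I \<in> L2 M" by (intro L2_sum gI)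
    have "L2_inner M (?s I) S = c * (\<Sum>i\<in>I. L2_inner M (g i) (g i))"
      using I inner gI S
      by (auto simp: L2_inner_commute[of M _ S] L2_inner_sum_right sum_distrib_left intro!: sum.cong)
    moreover have "L2_inner M (?s I) (?s I) = (\<Sum>i\<in>I. \<Sum>j\<in>I. L2_inner M (g i) (g j))"
      using gI sI by (simp add: L2_inner_sum_left L2_inner_sum_right)
    \<comment> \<open>In the expanded square the mixed term contributes -2 times \<open>c\<close>
      times the sum of squared norms, and the square of \<open>?s I\<close> at most +1 times the
      same quantity; so one negative copy remains.\<close>
    ultimately have "L2_inner M (\<lambda>x. ?s I x - S x) (\<lambda>x. ?s I x - S x)
        \<le> L2_inner M S S - c * (\<Sum>i\<in>I. L2_inner M (g i) (g i))"
      using bound[OF I] L2_inner_diff_self[OF sI S] by linarith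
    then show "norm (L2_inner M (\<lambda>x. ?s I x - S x) (\<lambda>x. ?s I x - S x))
        \<le> L2_inner M S S - c * (\<Sum>i\<in>I. L2_inner M (g i) (g i))"
      by (simp add: L2_inner_self_nonneg)
  qed
  then have "((\<lambda>I. L2norm M (\<lambda>x. ?s I x - S x)) \<longlongrightarrow> 0) (finite_subsets_at_top A)"
    by (rule L2norm_tendsto_zeroI)
  moreover have "\<forall>\<^sub>F I in finite_subsets_at_top A. ?s I \<in> L2 M"
    by (rule eventually_finite_subsets_at_top_weakI) (use g in \<open>auto intro!: L2_sum\<close>)
  ultimately show ?thesis
    using g S by (auto simp: L2_has_sum_def L2_tendsto_def)
qed

lemma L2_orthogonal_has_sumI:
  assumes g: "\<And>i. i \<in> A \<Longrightarrow> g i \<in> L2 M" and S: "S \<in> L2 M"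
    and orth: "\<And>i j. i \<in> A \<Longrightarrow> j \<in> A \<Longrightarrow> i \<noteq> j \<Longrightarrow> L2_inner M (g i) (g j) = 0"
    and inner: "\<And>i. i \<in> A \<Longrightarrow> L2_inner M S (g i) = L2_inner M (g i) (g i)"
    and norm: "((\<lambda>i. L2_inner M (g i) (g i)) has_sum L2_inner M S S) A"
  shows "L2_has_sum M g A S"
proof (rule L2_has_sumI[where c = 1])
  fix I assume I: "finite I" "I \<subseteq> A"
  have "(\<Sum>j\<in>I. L2_inner M (g i) (g j)) = L2_inner M (g i) (g i)" if "i \<in> I" for i
  proof -
    have "(\<Sum>j\<in>I. L2_inner M (g i) (g j)) = (\<Sum>j\<in>I. if j = i then L2_inner M (g i) (g j) else 0)"
      using that I orth by (intro sum.cong) auto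
    then show ?thesis using that I by simp
  qed
  then show "(\<Sum>i\<in>I. \<Sum>j\<in>I. L2_inner M (g i) (g j)) \<le> 1 * (\<Sum>i\<in>I. L2_inner M (g i) (g i))"
    by simp
qed (use assms in simp_all)

text \<open>By Pythagoras the squared distance of two partial sums along an exhaustion is a
  difference of the bounded increasing numbers \<open>a n\<close>. This gives a limit along one
  enumeration only; unconditional convergence follows once its squared norm is seen to be the full
  sum of squared norms.\<close>

lemma (in prob_space) L2_orthogonal_summable:
  fixes f :: "'i \<Rightarrow> 'a \<Rightarrow> real"
  assumes A: "countable A" and f: "\<And>i. i \<in> A \<Longrightarrow> f i \<in> L2 M"
    and orth: "\<And>i j. i \<in> A \<Longrightarrow> j \<in> A \<Longrightarrow> i \<noteq> j \<Longrightarrow> L2_inner M (f i) (f j) = 0"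
    and bound: "\<And>I. finite I \<Longrightarrow> I \<subseteq> A \<Longrightarrow> (\<Sum>i\<in>I. L2_inner M (f i) (f i)) \<le> C"
  shows "\<exists>S. L2_has_sum M f A S"
proof -
  \<comment> \<open>Intersecting with \<open>A\<close> matters for \<open>A = {}\<close>, where
    \<open>from_nat_into\<close> takes an unspecified value.\<close>
  define B where "B n = A \<inter> from_nat_into A ` {..<n}" for n
  have fin: "finite (B n)" and BA: "B n \<subseteq> A" for n by (auto simp: B_def)
  have mono: "B m \<subseteq> B n" if "m \<le> n" for m n using that by (auto simp: B_def)
  have ex_B: "\<exists>n. i \<in> B n" if "i \<in> A" for i
  proof -
    have "i = from_nat_into A (to_nat_on A i)" using that A by simp
    then have "i \<in> B (Suc (to_nat_on A i))" using that by (auto simp: B_def)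
    then show ?thesis ..
  qed
  define u where "u n x = (\<Sum>i\<in>B n. f i x)" for n x
  have u: "u n \<in> L2 M" for n unfolding u_def using f BA by (intro L2_sum) blast
  have inner_sum: "L2_inner M (\<lambda>x. \<Sum>j\<in>I. f j x) (f i) = (if i \<in> I then L2_inner M (f i) (f i) else 0)"
    if "finite I" "I \<subseteq> A" "i \<in> A" for i I
  proof -
    have "L2_inner M (\<lambda>x. \<Sum>j\<in>I. f j x) (f i) = (\<Sum>j\<in>I. L2_inner M (f j) (f i))"
      using that f by (intro L2_inner_sum_left) auto
    also have "\<dots> = (\<Sum>j\<in>I. if j = i then L2_inner M (f i) (f i) else 0)"
      using that orth by (intro sum.cong) auto
    finally show ?thesis using that by simp
  qed
  define a where "a n = (\<Sum>i\<in>B n. L2_inner M (f i) (f i))" for n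
  have dist_u: "(L2norm M (\<lambda>x. u n x - u m x))\<^sup>2 = a n - a m" if "m \<le> n" for m n
  proof -
    let ?D = "B n - B m"
    have D: "finite ?D" "?D \<subseteq> A" using fin BA by auto
    have "(\<lambda>x. u n x - u m x) = (\<lambda>x. \<Sum>i\<in>?D. f i x)"
      unfolding u_def using mono[OF that] fin by (simp add: sum_diff)
    moreover have "L2_inner M (\<lambda>x. \<Sum>i\<in>?D. f i x) (\<lambda>x. \<Sum>i\<in>?D. f i x)
        = (\<Sum>i\<in>?D. L2_inner M (\<lambda>x. \<Sum>i\<in>?D. f i x) (f i))"
      using D f by (intro L2_inner_sum_right L2_sum) auto
    moreover have "\<dots> = (\<Sum>i\<in>?D. L2_inner M (f i) (f i))"
      using D by (intro sum.cong refl) (subst inner_sum, auto)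
    moreover have "\<dots> = a n - a m"
      unfolding a_def using mono[OF that] fin by (simp add: sum_diff)
    ultimately show ?thesis by (simp add: L2norm_power2)
  qed
  have "convergent a"
  proof -
    have "Bseq a"
      using bound[OF fin BA]
      by (intro BseqI'[where K = C]) (simp add: a_def sum_nonneg L2_inner_self_nonneg)
    moreover have "incseq a"
      unfolding incseq_def a_def using mono fin by (auto intro!: sum_mono2 L2_inner_self_nonneg)
    ultimately show ?thesis by (intro Bseq_monoseq_convergent incseq_imp_monoseq)
  qed
  then have "Cauchy a" by (rule convergent_Cauchy)
  have "\<exists>S\<in>L2 M. (\<lambda>n. L2norm M (\<lambda>x. u n x - S x)) \<longlonglongrightarrow> 0"
  proof (rule L2_complete[OF u])
    fix e :: real assume "0 < e"
    with \<open>Cauchy a\<close> obtain N where N: "\<And>m n. m \<ge> N \<Longrightarrow> n \<ge> N \<Longrightarrow> \<bar>a m - a n\<bar> < e\<^sup>2"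
      unfolding Cauchy_def dist_real_def by (meson zero_less_power)
    have *: "L2norm M (\<lambda>x. u n x - u m x) \<le> e" if "m \<le> n" "m \<ge> N" for m n
    proof (rule power2_le_imp_le)
      show "(L2norm M (\<lambda>x. u n x - u m x))\<^sup>2 \<le> e\<^sup>2"
        using N[of n m] that by (simp add: dist_u)
    qed (use \<open>0 < e\<close> in simp)
    have "L2norm M (\<lambda>x. u m x - u n x) \<le> e" if "m \<ge> N" "n \<ge> N" for m n
      using *[of m n] *[of n m] that L2norm_minus_commute[of M "u m" "u n"] by (cases "m \<le> n") auto
    then show "\<exists>N. \<forall>m\<ge>N. \<forall>n\<ge>N. L2norm M (\<lambda>x. u m x - u n x) \<le> e" by blast
  qed
  then obtain S where S: "S \<in> L2 M" and lim: "(\<lambda>n. L2norm M (\<lambda>x. u n x - S x)) \<longlonglongrightarrow> 0" by blast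
  have tends: "L2_tendsto M u S sequentially"
    using S u lim by (simp add: L2_tendsto_def)
  have inner_S: "L2_inner M S (f i) = L2_inner M (f i) (f i)" if i: "i \<in> A" for i
  proof (rule LIMSEQ_unique)
    show "(\<lambda>n. L2_inner M (u n) (f i)) \<longlonglongrightarrow> L2_inner M S (f i)"
      by (rule L2_tendsto_imp_inner_tendsto[OF tends f[OF i]])
    obtain k where k: "i \<in> B k" using ex_B[OF i] ..
    have "\<forall>\<^sub>F n in sequentially. L2_inner M (u n) (f i) = L2_inner M (f i) (f i)"
      using eventually_ge_at_top[of k]
    proof eventually_elim
      case (elim n)
      then show ?case
        using inner_sum[OF fin BA i] k mono unfolding u_def by auto
    qed
    then show "(\<lambda>n. L2_inner M (u n) (f i)) \<longlonglongrightarrow> L2_inner M (f i) (f i)"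
      by (rule tendsto_eventually)
  qed
  \<comment> \<open>The same inner products equal \<open>a n\<close> by \<open>inner_S\<close>,
    which identifies the limit of \<open>a\<close> as the squared norm of \<open>S\<close>.\<close>
  have "(\<lambda>n. L2_inner M (u n) S) \<longlonglongrightarrow> L2_inner M S S"
    by (rule L2_tendsto_imp_inner_tendsto[OF tends S])
  moreover have "L2_inner M (u n) S = a n" for n
  proof -
    have "L2_inner M (u n) S = (\<Sum>i\<in>B n. L2_inner M (f i) S)"
      unfolding u_def using f BA S by (intro L2_inner_sum_left) blast+
    also have "\<dots> = a n"
      unfolding a_def using BA inner_S
      by (intro sum.cong) (auto simp: L2_inner_commute[of M _ S])
    finally show ?thesis .
  qed
  ultimately have a_lim: "a \<longlonglongrightarrow> L2_inner M S S" by simp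
  have "(\<lambda>i. L2_inner M (f i) (f i)) summable_on A"
    using bound L2_inner_self_nonneg
    by (intro nonneg_bdd_above_summable_on bdd_aboveI2[where M = C]) auto
  then obtain s where s: "((\<lambda>i. L2_inner M (f i) (f i)) has_sum s) A"
    by (auto simp: summable_on_def)
  \<comment> \<open>The sets \<open>B n\<close> eventually contain every finite subset of
    \<open>A\<close>, so the net limit \<open>s\<close> and the limit of the sequence
    \<open>a\<close> agree.\<close>
  have "filterlim B (finite_subsets_at_top A) sequentially"
    unfolding filterlim_finite_subsets_at_top
  proof (intro allI impI)
    fix I assume I: "finite I \<and> I \<subseteq> A"
    then have "\<forall>i\<in>I. \<exists>n. i \<in> B n" using ex_B by blast
    then obtain k where k: "\<And>i. i \<in> I \<Longrightarrow> i \<in> B (k i)" by metis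
    have "I \<subseteq> B n" if "n \<ge> Max (insert 0 (k ` I))" for n
    proof
      fix i assume "i \<in> I"
      then have "k i \<le> n" using that I by auto
      then show "i \<in> B n" using mono k \<open>i \<in> I\<close> by blast
    qed
    then show "\<forall>\<^sub>F n in sequentially. finite (B n) \<and> I \<subseteq> B n \<and> B n \<subseteq> A"
      using fin BA unfolding eventually_sequentially by blast
  qed
  with s have "a \<longlonglongrightarrow> s"
    unfolding has_sum_def a_def by (rule filterlim_compose)
  then have "s = L2_inner M S S" using a_lim by (rule LIMSEQ_unique)
  with s inner_S have "L2_has_sum M f A S"
    by (intro L2_orthogonal_has_sumI f S orth) auto
  then show ?thesis by blast
qed

section \<open>Conditional expectations and independence\<close>

text \<open>The sets on which both integrals agree form a Dynkin system; agreement on the whole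
  space is what closes it under complements.\<close>

lemma (in finite_measure) set_integral_eq_sigma_sets:
  fixes f g :: "'a \<Rightarrow> real"
  assumes f: "integrable M f" and g: "integrable M g"
    and G: "Int_stable G" "G \<subseteq> sets M" "space M \<in> G"
    and eq: "\<And>A. A \<in> G \<Longrightarrow> (\<integral>x\<in>A. f x \<partial>M) = (\<integral>x\<in>A. g x \<partial>M)"
    and A: "A \<in> sigma_sets (space M) G"
  shows "(\<integral>x\<in>A. f x \<partial>M) = (\<integral>x\<in>A. g x \<partial>M)"
proof -
  have GPow: "G \<subseteq> Pow (space M)" using G(2) sets.sets_into_space by blast
  have sets: "B \<in> sets M" if "B \<in> sigma_sets (space M) G" for B
    using that G(2) sets.sigma_sets_subset by blast
  have int: "set_integrable M B h" if "B \<in> sets M" "integrable M h" for B and h :: "'a \<Rightarrow> real"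
    using that integrable_mult_indicator[of B M h] by (simp add: set_integrable_def)
  show ?thesis
    using G(1) GPow A
  proof (induction rule: sigma_sets_induct_disjoint)
    case (compl B)
    have B: "B \<in> sets M" "space M - B \<in> sets M" using sets[OF compl(1)] by auto
    have split: "(\<integral>x\<in>space M. h x \<partial>M) = (\<integral>x\<in>B. h x \<partial>M) + (\<integral>x\<in>space M - B. h x \<partial>M)"
      if "integrable M h" for h :: "'a \<Rightarrow> real"
    proof -
      have "B \<union> (space M - B) = space M" using sets.sets_into_space[OF B(1)] by auto
      then show ?thesis
        using set_integral_Un[of B "space M - B" M h] int[OF B(1) that] int[OF B(2) that] by simp
    qed
    show ?case
      using split[OF f] split[OF g] eq[OF G(3)] compl(2) by linarith
  next
    case (union B)
    have B: "B i \<in> sets M" for i using union(2) sets by blast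
    have "B i \<inter> B j = {}" if "i \<noteq> j" for i j
      using union(1) that by (simp add: disjoint_family_on_def)
    then have "(\<integral>x\<in>(\<Union>i. B i). h x \<partial>M) = (\<Sum>i. \<integral>x\<in>B i. h x \<partial>M)"
      if "integrable M h" for h :: "'a \<Rightarrow> real"
      using B that by (intro lebesgue_integral_countable_add int) auto
    with f g union(3) show ?case by simp
  next
    case (basic B)
    then show ?case by (rule eq)
  qed (simp add: set_lebesgue_integral_def)
qed

text \<open>Conditional Jensen inequality for the square function.\<close>

lemma (in finite_measure_subalgebra) L2_real_cond_exp:
  assumes "f \<in> L2 M"
  shows "real_cond_exp M F f \<in> L2 M"
proof -
  have "integrable M (\<lambda>x. (real_cond_exp M F f x)\<^sup>2)"
    using assms L2_integrable[OF assms] finite_emeasure_space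
    by (intro integrable_convex_cond_exp[where I = UNIV] convex_power2) (auto simp: L2_def)
  then show ?thesis by (simp add: L2_def)
qed

text \<open>Conditional expectation acts as the orthogonal projection onto the
  \<open>F\<close>-measurable functions.\<close>

lemma (in finite_measure_subalgebra) L2_inner_real_cond_exp:
  assumes "f \<in> L2 M" "g \<in> L2 M" "g \<in> borel_measurable F"
  shows "L2_inner M g (real_cond_exp M F f) = L2_inner M g f"
  unfolding L2_inner_def using assms
  by (intro real_cond_exp_intg L2_mult_integrable) (auto dest: L2_measurable)

section \<open>Sigma-algebras generated by subfamilies of the sequence\<close>

lemma space_sigma_rv: "space (sigma_rv P E X J) = space P"
  by (simp add: sigma_rv_def space_measure_of_conv)

lemma sets_sigma_rv:
  "sets (sigma_rv P E X J) =
    sigma_sets (space P) (\<Union>j\<in>J. {X j -` B \<inter> space P | B. B \<in> sets (E j)})"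
  unfolding sigma_rv_def by (rule sets_measure_of) auto

lemma sets_sigma_rv_mono:
  "J \<subseteq> K \<Longrightarrow> sets (sigma_rv P E X J) \<subseteq> sets (sigma_rv P E X K)"
  unfolding sets_sigma_rv by (intro sigma_sets_mono') blast

lemma subalgebra_sigma_rv_mono:
  "J \<subseteq> K \<Longrightarrow> subalgebra (sigma_rv P E X K) (sigma_rv P E X J)"
  by (simp add: subalgebra_def space_sigma_rv sets_sigma_rv_mono)

lemma measurable_sigma_rv_mono:
  "J \<subseteq> K \<Longrightarrow> f \<in> borel_measurable (sigma_rv P E X J) \<Longrightarrow> f \<in> borel_measurable (sigma_rv P E X K)"
  by (rule measurable_from_subalg[OF subalgebra_sigma_rv_mono])

locale independent_sequence = prob_space P
  for P :: "'a measure" +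
  fixes E :: "nat \<Rightarrow> 'b measure" and X :: "nat \<Rightarrow> 'a \<Rightarrow> 'b"
  assumes indep: "indep_vars E X {1..}"
begin

abbreviation \<sigma> :: "nat set \<Rightarrow> 'a measure" where
  "\<sigma> J \<equiv> sigma_rv P E X J"

abbreviation cexp :: "nat set \<Rightarrow> ('a \<Rightarrow> real) \<Rightarrow> 'a \<Rightarrow> real" where
  "cexp J \<equiv> real_cond_exp P (\<sigma> J)"

abbreviation hcomp :: "('a \<Rightarrow> real) \<Rightarrow> nat set \<Rightarrow> 'a \<Rightarrow> real" where
  "hcomp \<equiv> hoeffding_comp P E X"

lemma subalgebra_sigma:
  assumes "J \<subseteq> {1..}"
  shows "subalgebra P (\<sigma> J)"
proof -
  have "X j \<in> measurable P (E j)" if "j \<in> J" for j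
    using indep assms that unfolding indep_vars_def2 by blast
  then have "(\<Union>j\<in>J. {X j -` B \<inter> space P | B. B \<in> sets (E j)}) \<subseteq> sets P"
    by (auto intro: measurable_sets)
  then show ?thesis
    by (simp add: subalgebra_def space_sigma_rv sets_sigma_rv sets.sigma_sets_subset)
qed

lemma finite_measure_subalgebra_sigma: "J \<subseteq> {1..} \<Longrightarrow> finite_measure_subalgebra P (\<sigma> J)"
  by (intro finite_measure_subalgebra.intro finite_measure_axioms
      finite_measure_subalgebra_axioms.intro subalgebra_sigma)

lemma sigma_finite_subalgebra_sigma: "J \<subseteq> {1..} \<Longrightarrow> sigma_finite_subalgebra P (\<sigma> J)"
  by (intro finite_measure_subalgebra_is_sigma_finite finite_measure_subalgebra_sigma)

lemmas cexp_L2 = finite_measure_subalgebra.L2_real_cond_exp[OF finite_measure_subalgebra_sigma]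
lemmas cexp_inner = finite_measure_subalgebra.L2_inner_real_cond_exp[OF finite_measure_subalgebra_sigma]
lemmas cexp_integrable = sigma_finite_subalgebra.real_cond_exp_int(1)[OF sigma_finite_subalgebra_sigma]
lemmas cexp_cong = sigma_finite_subalgebra.real_cond_exp_cong[OF sigma_finite_subalgebra_sigma]

text \<open>Independent families stable under intersection may be grouped into disjoint blocks whose
  generated sigma-algebras are again independent. The two blocks are packed into a family indexed by
  \<open>bool\<close>.\<close>

lemma prob_Int_disjoint:
  assumes KL: "K \<subseteq> {1..}" "L \<subseteq> {1..}" "K \<inter> L = {}"
    and B: "B \<in> sets (\<sigma> K)" and C: "C \<in> sets (\<sigma> L)"
  shows "prob (B \<inter> C) = prob B * prob C"
proof -
  let ?G = "\<lambda>j. {X j -` B \<inter> space P | B. B \<in> sets (E j)}"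
  let ?I = "case_bool K L"
  have "indep_sets ?G {1..}"
    using indep unfolding indep_vars_def2 by blast
  then have "indep_sets ?G (\<Union>b\<in>UNIV. ?I b)"
    by (rule indep_sets_mono_index[rotated]) (use KL in \<open>auto split: bool.splits\<close>)
  moreover have "Int_stable (?G j)" for j
  proof (rule Int_stableI)
    fix a b assume "a \<in> ?G j" "b \<in> ?G j"
    then obtain A B where "A \<in> sets (E j)" "B \<in> sets (E j)"
      and "a = X j -` A \<inter> space P" "b = X j -` B \<inter> space P" by blast
    then have "a \<inter> b = X j -` (A \<inter> B) \<inter> space P" "A \<inter> B \<in> sets (E j)" by auto
    then show "a \<inter> b \<in> ?G j" by blast
  qed
  moreover have "disjoint_family_on ?I UNIV"
    using KL by (auto simp: disjoint_family_on_def split: bool.split)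
  ultimately have "indep_sets (\<lambda>b. sigma_sets (space P) (\<Union>j\<in>?I b. ?G j)) UNIV"
    by (rule indep_sets_collect_sigma)
  then have "indep_set (sets (\<sigma> K)) (sets (\<sigma> L))"
    unfolding indep_set_def sets_sigma_rv
    by (rule indep_sets_mono_sets) (simp split: bool.split)
  then show ?thesis using B C by (rule indep_setD)
qed

text \<open>\<open>C\<close> is independent of \<open>\<sigma> L\<close>, so the conditional
  expectation of its indicator is the constant \<open>prob C\<close>; since the rest of the
  integrand is \<open>\<sigma> L\<close>-measurable, the indicator may be replaced by that
  constant.\<close>

lemma set_integral_Int_disjoint:
  assumes KL: "K \<subseteq> {1..}" "L \<subseteq> {1..}" "K \<inter> L = {}"
    and B: "B \<in> sets (\<sigma> L)" and C: "C \<in> sets (\<sigma> K)"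
    and h: "integrable P h" "h \<in> borel_measurable (\<sigma> L)"
  shows "(\<integral>x\<in>B \<inter> C. h x \<partial>P) = prob C * (\<integral>x\<in>B. h x \<partial>P)"
proof -
  interpret L: finite_measure_subalgebra P "\<sigma> L" by (rule finite_measure_subalgebra_sigma[OF KL(2)])
  note sub = subalgebra_sigma[OF KL(1)] subalgebra_sigma[OF KL(2)]
  have [measurable]: "B \<in> sets P" "C \<in> sets P"
    using B C sub by (auto simp: subalgebra_def)
  have ind: "AE x in P. cexp L (indicator C) x = prob C"
  proof (rule L.real_cond_exp_charact)
    fix A assume A: "A \<in> sets (\<sigma> L)"
    then have [measurable]: "A \<in> sets P" using sub by (auto simp: subalgebra_def)
    have "(\<integral>x\<in>A. indicator C x \<partial>P) = (\<integral>x. indicat_real (C \<inter> A) x \<partial>P)"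
      unfolding set_lebesgue_integral_def
      by (intro Bochner_Integration.integral_cong) (auto simp: indicator_def)
    also have "\<dots> = prob (C \<inter> A)" by simp
    also have "\<dots> = prob C * prob A" by (rule prob_Int_disjoint[OF KL C A])
    also have "\<dots> = (\<integral>x\<in>A. prob C \<partial>P)" by (simp add: set_lebesgue_integral_def)
    finally show "(\<integral>x\<in>A. indicator C x \<partial>P) = (\<integral>x\<in>A. prob C \<partial>P)" .
  qed (auto intro!: integrable_real_indicator simp: less_top[symmetric])
  have int: "integrable P (\<lambda>x. indicator B x * h x)"
    using integrable_mult_indicator[OF \<open>B \<in> sets P\<close> h(1)] by simp
  have "(\<integral>x\<in>B \<inter> C. h x \<partial>P) = (\<integral>x. (indicator B x * h x) * indicator C x \<partial>P)"
    unfolding set_lebesgue_integral_def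
    by (intro Bochner_Integration.integral_cong) (auto simp: indicator_def)
  also have "\<dots> = (\<integral>x. (indicator B x * h x) * cexp L (indicator C) x \<partial>P)"
  proof (rule L.real_cond_exp_intg(2)[symmetric])
    show "integrable P (\<lambda>x. indicat_real B x * h x * indicat_real C x)"
      using integrable_mult_indicator[OF \<open>C \<in> sets P\<close> int] by (simp add: mult.commute)
    show "(\<lambda>x. indicator B x * h x) \<in> borel_measurable (\<sigma> L)"
      using B h(2) by measurable
  qed auto
  also have "\<dots> = (\<integral>x. prob C * (indicator B x * h x) \<partial>P)"
    using ind h(1) by (intro integral_cong_AE) auto
  also have "\<dots> = prob C * (\<integral>x\<in>B. h x \<partial>P)"
    by (simp add: set_lebesgue_integral_def)
  finally show ?thesis .
qed

text \<open>The sets \<open>B \<inter> C\<close> with \<open>B\<close> depending on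
  \<open>K \<inter> L\<close> and \<open>C\<close> on \<open>K - L\<close> form a generator of
  \<open>\<sigma> K\<close> that is stable under intersection, so the defining integrals need
  checking only there. On such a set \<open>C\<close> splits off by independence from
  \<open>\<sigma> L\<close>, and over \<open>B\<close> both conditional expectations integrate like
  \<open>F\<close>.\<close>

lemma cexp_cexp:
  assumes KL: "K \<subseteq> {1..}" "L \<subseteq> {1..}" and F: "integrable P F"
  shows "AE x in P. cexp K (cexp L F) x = cexp (K \<inter> L) F x"
proof -
  interpret K: finite_measure_subalgebra P "\<sigma> K" by (rule finite_measure_subalgebra_sigma[OF KL(1)])
  interpret L: finite_measure_subalgebra P "\<sigma> L" by (rule finite_measure_subalgebra_sigma[OF KL(2)])
  have KL': "K \<inter> L \<subseteq> {1..}" "K - L \<subseteq> {1..}" "(K - L) \<inter> L = {}" using KL by auto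
  interpret KL: finite_measure_subalgebra P "\<sigma> (K \<inter> L)"
    by (rule finite_measure_subalgebra_sigma[OF KL'(1)])
  let ?G = "{B \<inter> C | B C. B \<in> sets (\<sigma> (K \<inter> L)) \<and> C \<in> sets (\<sigma> (K - L))}"
  show ?thesis
  proof (rule K.real_cond_exp_charact)
    fix A assume A: "A \<in> sets (\<sigma> K)"
    have "sets (\<sigma> K) \<subseteq> sigma_sets (space P) ?G"
      unfolding sets_sigma_rv[of P E X K]
    proof (rule sigma_sets_mono, safe)
      fix j B assume j: "j \<in> K" and B: "B \<in> sets (E j)"
      have top: "space P \<in> sets (\<sigma> J)" for J
        using sets.top[of "\<sigma> J"] by (simp add: space_sigma_rv)
      have gen: "X j -` B \<inter> space P \<in> sets (\<sigma> J)" if "j \<in> J" for J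
        unfolding sets_sigma_rv using that B by (intro sigma_sets.Basic) blast
      have "X j -` B \<inter> space P \<in> ?G"
      proof (cases "j \<in> L")
        case True
        then have "X j -` B \<inter> space P \<in> sets (\<sigma> (K \<inter> L))" using j by (intro gen) blast
        then show ?thesis using top[of "K - L"] by blast
      next
        case False
        then have "X j -` B \<inter> space P \<in> sets (\<sigma> (K - L))" using j by (intro gen) blast
        moreover have "X j -` B \<inter> space P = space P \<inter> (X j -` B \<inter> space P)" by blast
        ultimately show ?thesis using top[of "K \<inter> L"] by blast
      qed
      then show "X j -` B \<inter> space P \<in> sigma_sets (space P) ?G" by (rule sigma_sets.Basic)
    qed
    with A have A: "A \<in> sigma_sets (space P) ?G" by blast
    show "(\<integral>x\<in>A. cexp L F x \<partial>P) = (\<integral>x\<in>A. cexp (K \<inter> L) F x \<partial>P)"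
    proof (rule set_integral_eq_sigma_sets[OF _ _ _ _ _ _ A])
      show "Int_stable ?G"
      proof (rule Int_stableI)
        fix a b assume "a \<in> ?G" "b \<in> ?G"
        then obtain B C B' C' where "B \<in> sets (\<sigma> (K \<inter> L))" "C \<in> sets (\<sigma> (K - L))"
          "B' \<in> sets (\<sigma> (K \<inter> L))" "C' \<in> sets (\<sigma> (K - L))" "a = B \<inter> C" "b = B' \<inter> C'" by blast
        moreover from this have "a \<inter> b = (B \<inter> B') \<inter> (C \<inter> C')" by blast
        ultimately show "a \<inter> b \<in> ?G" by blast
      qed
      show "?G \<subseteq> sets P"
        using KL.subalg subalgebra_sigma[OF KL'(2)] by (auto simp: subalgebra_def)
      show "space P \<in> ?G"
        using sets.top[of "\<sigma> (K \<inter> L)"] sets.top[of "\<sigma> (K - L)"] by (auto simp: space_sigma_rv)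
      fix A assume "A \<in> ?G"
      then obtain B C where B: "B \<in> sets (\<sigma> (K \<inter> L))" and C: "C \<in> sets (\<sigma> (K - L))"
        and A: "A = B \<inter> C" by blast
      have BL: "B \<in> sets (\<sigma> L)" using B sets_sigma_rv_mono[of "K \<inter> L" L P E X] by auto
      have "(\<integral>x\<in>A. cexp L F x \<partial>P) = prob C * (\<integral>x\<in>B. cexp L F x \<partial>P)"
        unfolding A using F
        by (intro set_integral_Int_disjoint[OF KL'(2) KL(2) KL'(3) BL C] L.real_cond_exp_int) auto
      also have "(\<integral>x\<in>B. cexp L F x \<partial>P) = (\<integral>x\<in>B. cexp (K \<inter> L) F x \<partial>P)"
        using L.real_cond_exp_intA[OF F BL] KL.real_cond_exp_intA[OF F B] by simp
      \<comment> \<open>The same factorisation read backwards; \<open>cexp (K \<inter> L) F\<close>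
        is also \<open>\<sigma> L\<close>-measurable.\<close>
      also have "prob C * (\<integral>x\<in>B. cexp (K \<inter> L) F x \<partial>P) = (\<integral>x\<in>A. cexp (K \<inter> L) F x \<partial>P)"
        unfolding A using F
        by (intro set_integral_Int_disjoint[OF KL'(2) KL(2) KL'(3) BL C, symmetric]
            KL.real_cond_exp_int measurable_sigma_rv_mono[of "K \<inter> L" L]) auto
      finally show "(\<integral>x\<in>A. cexp L F x \<partial>P) = (\<integral>x\<in>A. cexp (K \<inter> L) F x \<partial>P)" .
    qed (use F in \<open>auto intro: L.real_cond_exp_int KL.real_cond_exp_int\<close>)
  next
    show "cexp (K \<inter> L) F \<in> borel_measurable (\<sigma> K)"
      by (rule measurable_sigma_rv_mono[of "K \<inter> L" K]) auto
  qed (use F in \<open>auto intro: L.real_cond_exp_int KL.real_cond_exp_int\<close>)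
qed

text \<open>Inner products of conditional expectations of \<open>F\<close> depend only on the
  intersection of the index sets, which turns orthogonality of the components into combinatorics of
  subsets.\<close>

lemma inner_cexp_cexp:
  assumes KL: "K \<subseteq> {1..}" "L \<subseteq> {1..}" and F: "F \<in> L2 P"
  shows "L2_inner P (cexp K F) (cexp L F) = L2_inner P (cexp (K \<inter> L) F) F"
proof -
  have KL': "K \<inter> L \<subseteq> {1..}" using KL by auto
  have "L2_inner P (cexp K F) (cexp L F) = L2_inner P (cexp K F) (cexp K (cexp L F))"
    using cexp_inner[OF KL(1) cexp_L2[OF KL(2) F] cexp_L2[OF KL(1) F]] by simp
  also have "\<dots> = L2_inner P (cexp K F) (cexp (K \<inter> L) F)"
    using cexp_cexp[OF KL L2_integrable[OF F]] by (intro L2_inner_cong_AE) auto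
  also have "\<dots> = L2_inner P (cexp (K \<inter> L) F) (cexp K F)"
    by (rule L2_inner_commute)
  also have "\<dots> = L2_inner P (cexp (K \<inter> L) F) F"
    by (intro cexp_inner[OF KL(1) F cexp_L2[OF KL' F]] measurable_sigma_rv_mono[of "K \<inter> L" K]) auto
  finally show ?thesis .
qed

lemma cexp_top:
  assumes "integrable P F" "F \<in> borel_measurable (\<sigma> {1..})"
  shows "AE x in P. cexp {1..} F x = F x"
  using sigma_finite_subalgebra.real_cond_exp_F_meas[OF sigma_finite_subalgebra_sigma] assms by blast

lemma cexp_empty:
  assumes "integrable P F"
  shows "AE x in P. cexp {} F x = expectation F"
proof (rule sigma_finite_subalgebra.real_cond_exp_charact[OF sigma_finite_subalgebra_sigma])
  fix A assume "A \<in> sets (\<sigma> {})"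
  then have "A = {} \<or> A = space P" by (simp add: sets_sigma_rv sigma_sets_empty_eq)
  then show "(\<integral>x\<in>A. F x \<partial>P) = (\<integral>x\<in>A. expectation F \<partial>P)"
    using assms by (auto simp: set_lebesgue_integral_def[of P "{}"] set_integral_space prob_space)
qed (use assms in auto)

end

section \<open>The Hoeffding decomposition\<close>

text \<open>\<open>L\<close> and \<open>insert i L\<close> enter with opposite signs and the same
  value of \<open>g\<close>, so they cancel in pairs.\<close>

lemma alternating_sum_Pow_eq_0:
  fixes g :: "'i set \<Rightarrow> real"
  assumes M: "finite M" "i \<in> M" and g: "\<And>L. L \<subseteq> M - {i} \<Longrightarrow> g (insert i L) = g L"
  shows "(\<Sum>L\<in>Pow M. (-1) ^ (card M - card L) * g L) = 0"
proof -
  define N where "N = M - {i}"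
  have N: "M = insert i N" "i \<notin> N" "finite N" using M by (auto simp: N_def)
  have inj: "inj_on (insert i) (Pow N)" using N(2) by (auto simp: inj_on_def)
  have "(\<Sum>L\<in>Pow M. (-1) ^ (card M - card L) * g L) =
      (\<Sum>L\<in>Pow N. (-1) ^ (card M - card L) * g L)
      + (\<Sum>L\<in>insert i ` Pow N. (-1) ^ (card M - card L) * g L)"
    unfolding N(1) Pow_insert using N by (intro sum.union_disjoint) auto
  also have "(\<Sum>L\<in>insert i ` Pow N. (-1) ^ (card M - card L) * g L) =
      (\<Sum>L\<in>Pow N. - ((-1) ^ (card M - card L) * g L))"
    unfolding sum.reindex[OF inj]
  proof (rule sum.cong)
    fix L assume "L \<in> Pow N"
    then have L: "L \<subseteq> N" "finite L" "i \<notin> L" using N finite_subset by auto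
    then have "card L \<le> card N" using N(3) by (intro card_mono)
    \<comment> \<open>The natural subtraction does not truncate, because \<open>card L\<close> is at
      most \<open>card N = card M - 1\<close>.\<close>
    then have "card M - card L = Suc (card M - card (insert i L))"
      using L N by simp
    moreover have "g (insert i L) = g L" using L g by (auto simp: N_def)
    ultimately show "((\<lambda>L. (-1) ^ (card M - card L) * g L) \<circ> insert i) L = - ((-1) ^ (card M - card L) * g L)"
      by simp
  qed simp
  finally show ?thesis by (simp add: sum_negf)
qed

text \<open>\<open>J\<close> is the disjoint union of the fibres of \<open>\<pi>\<close>, and each
  contributes \<open>c\<close> copies of one term; nonnegativity yields the summability over pairs
  that this regrouping requires.\<close>

lemma has_sum_fibres:
  fixes f :: "'m \<Rightarrow> real"
  assumes f: "(f has_sum s) A" and nonneg: "\<And>m. m \<in> A \<Longrightarrow> 0 \<le> f m"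
    and \<pi>: "\<pi> ` J \<subseteq> A"
    and fibres: "\<And>m. m \<in> A \<Longrightarrow> finite {j\<in>J. \<pi> j = m} \<and> card {j\<in>J. \<pi> j = m} = c"
  shows "((\<lambda>j. f (\<pi> j)) has_sum (real c * s)) J"
proof -
  let ?B = "\<lambda>m. {j\<in>J. \<pi> j = m}"
  have inner: "((\<lambda>j. (f \<circ> fst) (m, j)) has_sum (real c * f m)) (?B m)" if "m \<in> A" for m
    using fibres[OF that] by (intro has_sum_finiteI) auto
  have outer: "((\<lambda>m. real c * f m) has_sum (real c * s)) A"
    by (rule has_sum_cmult_right[OF f])
  have "((f \<circ> fst) has_sum (real c * s)) (Sigma A ?B)"
    using inner outer nonneg
    by (intro has_sum_SigmaI summable_on_SigmaI[OF inner]) (auto intro: has_sum_imp_summable)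
  moreover have "bij_betw (\<lambda>j. (\<pi> j, j)) J (Sigma A ?B)"
    using \<pi> by (intro bij_betw_byWitness[where f' = snd]) auto
  ultimately show ?thesis
    using has_sum_reindex_bij_betw[of "\<lambda>j. (\<pi> j, j)" J "Sigma A ?B" "f \<circ> fst"] by simp
qed

text \<open>Testing the sum against \<open>h m\<close> leaves one term; testing it against
  \<open>S\<close> itself then gives Parseval's identity.\<close>

lemma L2_has_sum_orthogonal:
  assumes S: "L2_has_sum M h A S"
    and orth: "\<And>m n. m \<in> A \<Longrightarrow> n \<in> A \<Longrightarrow> m \<noteq> n \<Longrightarrow> L2_inner M (h m) (h n) = 0"
  shows "\<And>m. m \<in> A \<Longrightarrow> L2_inner M S (h m) = L2_inner M (h m) (h m)"
    and "((\<lambda>m. L2_inner M (h m) (h m)) has_sum L2_inner M S S) A"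
proof -
  have L2: "S \<in> L2 M" "\<And>m. m \<in> A \<Longrightarrow> h m \<in> L2 M"
    using S by (auto simp: L2_has_sum_def L2_tendsto_def)
  show inner: "L2_inner M S (h m) = L2_inner M (h m) (h m)" if m: "m \<in> A" for m
  proof (rule has_sum_unique)
    show "((\<lambda>n. L2_inner M (h n) (h m)) has_sum L2_inner M S (h m)) A"
      by (rule L2_has_sum_imp_inner_has_sum[OF S L2(2)[OF m]])
    have "((\<lambda>n. L2_inner M (h n) (h m)) has_sum L2_inner M (h m) (h m)) {m}"
      by (intro has_sum_finiteI) auto
    then show "((\<lambda>n. L2_inner M (h n) (h m)) has_sum L2_inner M (h m) (h m)) A"
      by (rule has_sum_cong_neutral[THEN iffD1, rotated -1]) (use m orth in auto)
  qed
  have "((\<lambda>m. L2_inner M (h m) S) has_sum L2_inner M S S) A"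
    by (rule L2_has_sum_imp_inner_has_sum[OF S L2(1)])
  then show "((\<lambda>m. L2_inner M (h m) (h m)) has_sum L2_inner M S S) A"
    by (rule has_sum_cong[THEN iffD1, rotated]) (simp add: L2_inner_commute[of M _ S] inner)
qed

text \<open>Passes from sets to tuples: \<open>\<pi>\<close> sends a tuple to its set of entries,
  and \<open>k j\<close> is another representative of \<open>h (\<pi> j)\<close>. Each component
  occurs \<open>c\<close> times, whence the limit \<open>c\<close> times \<open>S\<close>.\<close>

lemma L2_has_sum_fibres:
  assumes S: "L2_has_sum M h A S"
    and orth: "\<And>m n. m \<in> A \<Longrightarrow> n \<in> A \<Longrightarrow> m \<noteq> n \<Longrightarrow> L2_inner M (h m) (h n) = 0"
    and \<pi>: "\<pi> ` J \<subseteq> A"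
    and fibres: "\<And>m. m \<in> A \<Longrightarrow> finite {j\<in>J. \<pi> j = m} \<and> card {j\<in>J. \<pi> j = m} = c"
    and k: "\<And>j. j \<in> J \<Longrightarrow> k j \<in> borel_measurable M"
    and kh: "\<And>j. j \<in> J \<Longrightarrow> AE x in M. h (\<pi> j) x = k j x"
  shows "L2_has_sum M k J (\<lambda>x. real c * S x)"
proof -
  have S_L2: "S \<in> L2 M" and h: "\<And>m. m \<in> A \<Longrightarrow> h m \<in> L2 M"
    using S by (auto simp: L2_has_sum_def L2_tendsto_def)
  have hJ: "h (\<pi> j) \<in> L2 M" if "j \<in> J" for j using that \<pi> h by blast
  have k_L2: "k j \<in> L2 M" if "j \<in> J" for j
    using L2_cong_AE[OF hJ k kh] that by blast
  have inner_k: "L2_inner M (k i) (k j) = L2_inner M (h (\<pi> i)) (h (\<pi> j))"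
    if "i \<in> J" "j \<in> J" for i j
    using that k kh hJ[THEN L2_measurable] by (intro L2_inner_cong_AE) (auto simp: eq_commute)
  have inner_S: "L2_inner M S (k j) = L2_inner M S (h (\<pi> j))" if "j \<in> J" for j
    using that k kh hJ[THEN L2_measurable] S_L2[THEN L2_measurable]
    by (intro L2_inner_cong_AE) (auto simp: eq_commute)
  have inner_cS: "L2_inner M (\<lambda>x. real c * S x) (k j) = real c * L2_inner M (k j) (k j)"
    if j: "j \<in> J" for j
    using L2_has_sum_orthogonal(1)[OF S orth, of "\<pi> j"] j \<pi>
    by (auto simp: L2_inner_cmult_left inner_S inner_k)
  show ?thesis
  proof (rule L2_has_sumI[where c = "real c"])
    fix I assume I: "finite I" "I \<subseteq> J"
    have "(\<Sum>j\<in>I. L2_inner M (k i) (k j)) \<le> real c * L2_inner M (k i) (k i)" if i: "i \<in> I" for i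
    proof -
      have \<pi>i: "\<pi> i \<in> A" using i I \<pi> by blast
      have "(\<Sum>j\<in>I. L2_inner M (k i) (k j)) =
          (\<Sum>j\<in>I. if \<pi> j = \<pi> i then L2_inner M (k i) (k i) else 0)"
      proof (rule sum.cong)
        fix j assume j: "j \<in> I"
        then have "\<pi> j \<in> A" using I \<pi> by blast
        then show "L2_inner M (k i) (k j) = (if \<pi> j = \<pi> i then L2_inner M (k i) (k i) else 0)"
          using i j I \<pi>i orth by (auto simp: inner_k subset_eq)
      qed simp
      also have "\<dots> = real (card {j\<in>I. \<pi> j = \<pi> i}) * L2_inner M (k i) (k i)"
        using I by (simp add: sum.If_cases Int_def)
      \<comment> \<open>Only an inequality, since the finite set \<open>I\<close> may contain just a
        part of the fibre.\<close>
      also have "\<dots> \<le> real c * L2_inner M (k i) (k i)"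
      proof (intro mult_right_mono L2_inner_self_nonneg of_nat_mono)
        show "card {j\<in>I. \<pi> j = \<pi> i} \<le> c"
          using fibres[OF \<pi>i] I by (auto intro: card_mono)
      qed
      finally show ?thesis .
    qed
    then show "(\<Sum>i\<in>I. \<Sum>j\<in>I. L2_inner M (k i) (k j)) \<le> real c * (\<Sum>i\<in>I. L2_inner M (k i) (k i))"
      by (simp add: sum_distrib_left sum_mono)
  next
    \<comment> \<open>One factor \<open>c\<close> comes from the fibres, the second from the
      multiplication below; together they give the squared norm of \<open>c\<close> times
      \<open>S\<close>.\<close>
    have "((\<lambda>j. L2_inner M (h (\<pi> j)) (h (\<pi> j))) has_sum (real c * L2_inner M S S)) J"
      using has_sum_fibres[OF L2_has_sum_orthogonal(2)[OF S orth] L2_inner_self_nonneg \<pi> fibres] .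
    then have "((\<lambda>j. real c * L2_inner M (h (\<pi> j)) (h (\<pi> j))) has_sum
        (real c * (real c * L2_inner M S S))) J"
      by (rule has_sum_cmult_right)
    moreover have "L2_inner M (\<lambda>x. real c * S x) (\<lambda>x. real c * S x) = real c * (real c * L2_inner M S S)"
      by (simp add: L2_inner_cmult_left L2_inner_commute[of M S "\<lambda>x. real c * S x"])
    ultimately show "((\<lambda>j. real c * L2_inner M (k j) (k j)) has_sum
        L2_inner M (\<lambda>x. real c * S x) (\<lambda>x. real c * S x)) J"
      by (subst has_sum_cong[where g = "\<lambda>j. real c * L2_inner M (h (\<pi> j)) (h (\<pi> j))"])
        (simp_all add: inner_k)
  qed (use S_L2 k_L2 inner_cS in \<open>auto intro: L2_cmult\<close>)
qed

section \<open>Hoeffding components: inversion, Bessel's inequality and Parseval's identity\<close>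

context independent_sequence
begin

lemma hcomp_eq: "hcomp F M x = (\<Sum>L\<in>Pow M. (-1) ^ (card M - card L) * cexp L F x)"
  by (simp add: hoeffding_comp_def)

lemma hcomp_measurable: "hcomp F M \<in> borel_measurable (\<sigma> M)"
proof -
  have "cexp L F \<in> borel_measurable (\<sigma> M)" if "L \<subseteq> M" for L
    by (rule measurable_sigma_rv_mono[OF that]) simp
  then show ?thesis unfolding hoeffding_comp_def by (intro borel_measurable_sum borel_measurable_times) auto
qed

lemma hcomp_L2:
  assumes "M \<subseteq> {1..}" "F \<in> L2 P"
  shows "hcomp F M \<in> L2 P"
  unfolding hoeffding_comp_def
  by (rule L2_sum, rule L2_cmult, rule cexp_L2) (use assms in auto)

lemma inner_hcomp:
  assumes "M \<subseteq> {1..}" "F \<in> L2 P" "G \<in> L2 P"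
  shows "L2_inner P (hcomp F M) G =
    (\<Sum>L\<in>Pow M. (-1) ^ (card M - card L) * L2_inner P (cexp L F) G)"
  unfolding hoeffding_comp_def using assms
  by (subst L2_inner_sum_left) (auto intro!: L2_cmult cexp_L2 simp: L2_inner_cmult_left)

text \<open>Moebius inversion on the lattice of finite subsets.\<close>

lemma sum_hcomp_Pow:
  assumes "finite K"
  shows "(\<Sum>M\<in>Pow K. hcomp F M x) = cexp K F x"
proof -
  \<comment> \<open>Multiplying by \<open>(-1) ^ card M\<close> produces the symmetric form of
    inclusion-exclusion; applying the sign twice removes it again.\<close>
  have "(-1) ^ card M * hcomp F M x = (\<Sum>L\<in>Pow M. (-1) ^ card L * cexp L F x)"
    if "finite M" for M
  proof -
    have sign: "(-1) ^ card M * ((-1) ^ (card M - card L) * cexp L F x) = (-1) ^ card L * cexp L F x"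
      if "L \<in> Pow M" for L
    proof -
      have "card L \<le> card M" using that \<open>finite M\<close> by (auto intro: card_mono)
      then obtain d where d: "card M = card L + d" using le_Suc_ex by blast
      have "(-1) ^ d * (-1) ^ d = (1 :: real)" by (simp flip: power_mult_distrib)
      then show ?thesis by (simp add: d power_add)
    qed
    show ?thesis unfolding hcomp_eq sum_distrib_left by (intro sum.cong refl sign)
  qed
  from inclusion_exclusion_symmetric[of "\<lambda>M. (-1) ^ card M * hcomp F M x", OF this assms]
  show ?thesis by (simp flip: mult.assoc power_add)
qed

text \<open>Expanding the left factor gives an alternating sum over \<open>L \<subseteq> M\<close> whose terms depend on \<open>L\<close>
  only through the sets \<open>L \<inter> L'\<close> with \<open>L' \<subseteq> N\<close>; toggling an index of \<open>M - N\<close> leaves them unchanged.\<close>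

lemma hcomp_orthogonal:
  assumes M: "finite M" "M \<subseteq> {1..}" and N: "finite N" "N \<subseteq> {1..}" and "M \<noteq> N" and F: "F \<in> L2 P"
  shows "L2_inner P (hcomp F M) (hcomp F N) = 0"
proof -
  have *: "L2_inner P (hcomp F M) (hcomp F N) = 0"
    if M: "finite M" "M \<subseteq> {1..}" and N: "N \<subseteq> {1..}" and i: "i \<in> M" "i \<notin> N" for M N i
  proof -
    have inner: "L2_inner P (cexp L F) (hcomp F N) =
        (\<Sum>L'\<in>Pow N. (-1) ^ (card N - card L') * L2_inner P (cexp (L \<inter> L') F) F)"
      if "L \<subseteq> {1..}" for L
    proof -
      have "L2_inner P (cexp L' F) (cexp L F) = L2_inner P (cexp (L \<inter> L') F) F" if "L' \<in> Pow N" for L'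
        using inner_cexp_cexp[of L' L F] that N \<open>L \<subseteq> {1..}\<close> F by (auto simp: Int_commute)
      then show ?thesis
        using that N F by (simp add: L2_inner_commute[of P "cexp L F"] inner_hcomp cexp_L2)
    qed
    have "(\<Sum>L\<in>Pow M. (-1) ^ (card M - card L) * L2_inner P (cexp L F) (hcomp F N)) = 0"
    proof (rule alternating_sum_Pow_eq_0[OF M(1) i(1)])
      fix L assume "L \<subseteq> M - {i}"
      then have "L \<subseteq> {1..}" "insert i L \<subseteq> {1..}" using M i by auto
      moreover have "insert i L \<inter> L' = L \<inter> L'" if "L' \<in> Pow N" for L' using that i by auto
      ultimately show "L2_inner P (cexp (insert i L) F) (hcomp F N) = L2_inner P (cexp L F) (hcomp F N)"
        unfolding inner[OF \<open>L \<subseteq> {1..}\<close>] inner[OF \<open>insert i L \<subseteq> {1..}\<close>] by simp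
    qed
    then show ?thesis using M N F by (simp add: inner_hcomp hcomp_L2)
  qed
  consider i where "i \<in> M" "i \<notin> N" | i where "i \<in> N" "i \<notin> M" using \<open>M \<noteq> N\<close> by blast
  then show ?thesis
  proof cases
    case 1
    then show ?thesis using *[OF M N(2)] by blast
  next
    case 2
    then show ?thesis using *[OF N M(2)] L2_inner_commute[of P "hcomp F M"] by metis
  qed
qed

text \<open>\<open>hcomp F M\<close> is \<open>\<sigma> M\<close>-measurable, so \<open>F\<close>
  may be replaced by \<open>cexp M F\<close>, the finite sum of the components inside
  \<open>M\<close>; orthogonality leaves only \<open>M\<close> itself.\<close>

lemma inner_hcomp_self:
  assumes M: "finite M" "M \<subseteq> {1..}" and F: "F \<in> L2 P"
  shows "L2_inner P (hcomp F M) F = L2_inner P (hcomp F M) (hcomp F M)"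
proof -
  have sub: "N \<subseteq> {1..}" "finite N" if "N \<in> Pow M" for N using that M finite_subset by auto
  have "L2_inner P (hcomp F M) F = L2_inner P (hcomp F M) (cexp M F)"
    using cexp_inner[OF M(2) F hcomp_L2[OF M(2) F] hcomp_measurable] by simp
  also have "\<dots> = L2_inner P (hcomp F M) (\<lambda>x. \<Sum>N\<in>Pow M. hcomp F N x)"
    by (simp add: sum_hcomp_Pow[OF M(1)])
  also have "\<dots> = (\<Sum>N\<in>Pow M. L2_inner P (hcomp F M) (hcomp F N))"
    using sub M F by (intro L2_inner_sum_right hcomp_L2) auto
  also have "\<dots> = (\<Sum>N\<in>Pow M. if N = M then L2_inner P (hcomp F M) (hcomp F M) else 0)"
    using sub M F hcomp_orthogonal by (intro sum.cong) auto
  also have "\<dots> = L2_inner P (hcomp F M) (hcomp F M)"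
    using M by simp
  finally show ?thesis .
qed

text \<open>The partial sum has the same inner product with \<open>F\<close> as with itself, so the
  squared norm of the remainder is the difference of the two sides.\<close>

lemma hcomp_Bessel:
  assumes I: "finite I" "\<And>M. M \<in> I \<Longrightarrow> finite M \<and> M \<subseteq> {1..}" and F: "F \<in> L2 P"
  shows "(\<Sum>M\<in>I. L2_inner P (hcomp F M) (hcomp F M)) \<le> L2_inner P F F"
proof -
  let ?s = "\<lambda>x. \<Sum>M\<in>I. hcomp F M x"
  have s: "?s \<in> L2 P" using I F by (intro L2_sum hcomp_L2) auto
  have "L2_inner P F ?s = (\<Sum>M\<in>I. L2_inner P F (hcomp F M))"
    using I F by (intro L2_inner_sum_right hcomp_L2) auto
  also have "\<dots> = (\<Sum>M\<in>I. L2_inner P (hcomp F M) (hcomp F M))"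
    using I F by (intro sum.cong refl) (metis L2_inner_commute inner_hcomp_self)
  finally have "L2_inner P F ?s = (\<Sum>M\<in>I. L2_inner P (hcomp F M) (hcomp F M))" .
  moreover have "L2_inner P ?s ?s = (\<Sum>M\<in>I. L2_inner P (hcomp F M) (hcomp F M))"
  proof -
    have "L2_inner P ?s ?s = (\<Sum>M\<in>I. \<Sum>N\<in>I. L2_inner P (hcomp F M) (hcomp F N))"
      using I F s by (simp add: L2_inner_sum_left L2_inner_sum_right hcomp_L2)
    also have "\<dots> = (\<Sum>M\<in>I. \<Sum>N\<in>I. if N = M then L2_inner P (hcomp F M) (hcomp F M) else 0)"
      using I F hcomp_orthogonal by (intro sum.cong) auto
    finally show ?thesis using I by simp
  qed
  ultimately show ?thesis
    using L2_inner_diff_self[OF F s] L2_inner_self_nonneg[of P "\<lambda>x. F x - ?s x"] by linarith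
qed

text \<open>\<open>A\<close> is left general: Parseval's identity uses all finite index sets, the
  level sums those of one cardinality.\<close>

lemma hcomp_summable:
  assumes A: "A \<subseteq> {M. finite M \<and> M \<subseteq> {1..}}" and F: "F \<in> L2 P"
  shows "\<exists>S. L2_has_sum P (hcomp F) A S"
proof (rule L2_orthogonal_summable)
  show "countable A"
    by (rule countable_subset[OF _ countable_Collect_finite]) (use A in blast)
  show "(\<Sum>M\<in>I. L2_inner P (hcomp F M) (hcomp F M)) \<le> L2_inner P F F" if "finite I" "I \<subseteq> A" for I
    using that A F by (intro hcomp_Bessel) auto
  show "hcomp F M \<in> L2 P" if "M \<in> A" for M
    using that A F by (intro hcomp_L2) blast+
  show "L2_inner P (hcomp F M) (hcomp F N) = 0" if "M \<in> A" "N \<in> A" "M \<noteq> N" for M N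
    using that A F by (intro hcomp_orthogonal) blast+
qed

text \<open>The sum \<open>S\<close> of all components has the same integrals as \<open>F\<close> over all events that depend on
  finitely many \<open>X j\<close>, hence \<open>cexp {1..} S = F\<close>; pairing with \<open>F\<close> gives Parseval's identity.\<close>

lemma hcomp_Parseval:
  assumes F: "F \<in> L2 P" "F \<in> borel_measurable (\<sigma> {1..})"
  shows "((\<lambda>M. L2_inner P (hcomp F M) (hcomp F M)) has_sum L2_inner P F F)
    {M. finite M \<and> M \<subseteq> {1..}}"
proof -
  let ?A = "{M :: nat set. finite M \<and> M \<subseteq> {1..}}"
  obtain S where S: "L2_has_sum P (hcomp F) ?A S"
    using hcomp_summable[OF subset_refl F(1)] by blast
  then have S_L2: "S \<in> L2 P" by (simp add: L2_has_sum_def L2_tendsto_def)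
  \<comment> \<open>Along these families the partial sums are \<open>cexp {1..n} F\<close> by
    \<open>sum_hcomp_Pow\<close>.\<close>
  have lim: "filterlim (\<lambda>n. Pow {1..n}) (finite_subsets_at_top ?A) sequentially"
    unfolding filterlim_finite_subsets_at_top
  proof (intro allI impI)
    fix I assume I: "finite I \<and> I \<subseteq> ?A"
    then have "finite (\<Union>I)" by blast
    then obtain N where N: "\<Union>I \<subseteq> {..N}" using finite_nat_iff_bounded_le by blast
    have "I \<subseteq> Pow {1..n}" if "n \<ge> N" for n
    proof
      fix M assume "M \<in> I"
      then have "M \<subseteq> {..N}" "M \<subseteq> {1..}" using N I by auto
      then show "M \<in> Pow {1..n}" using that by fastforce
    qed
    moreover have "Pow {1..n} \<subseteq> ?A" for n using finite_subset by fastforce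
    ultimately show "\<forall>\<^sub>F n in sequentially. finite (Pow {1..n}) \<and> I \<subseteq> Pow {1..n} \<and> Pow {1..n} \<subseteq> ?A"
      unfolding eventually_sequentially by (metis finite_Pow_iff finite_atLeastAtMost)
  qed
  have cexp_lim: "(\<lambda>n. L2_inner P (cexp {1..n} F) G) \<longlonglongrightarrow> L2_inner P S G" if G: "G \<in> L2 P" for G
  proof -
    have "(\<lambda>n. \<Sum>M\<in>Pow {1..n}. L2_inner P (hcomp F M) G) \<longlonglongrightarrow> L2_inner P S G"
      using L2_has_sum_imp_inner_has_sum[OF S G] lim unfolding has_sum_def by (rule filterlim_compose)
    moreover have "(\<Sum>M\<in>Pow {1..n}. L2_inner P (hcomp F M) G) = L2_inner P (cexp {1..n} F) G" for n
    proof -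
      have "(\<Sum>M\<in>Pow {1..n}. L2_inner P (hcomp F M) G) =
          L2_inner P (\<lambda>x. \<Sum>M\<in>Pow {1..n}. hcomp F M x) G"
        using F G by (intro L2_inner_sum_left[symmetric] hcomp_L2) auto
      then show ?thesis by (simp add: sum_hcomp_Pow)
    qed
    ultimately show ?thesis by simp
  qed
  let ?G = "\<Union>n. sets (\<sigma> {1..n})"
  have sub: "{1..n} \<subseteq> {1..}" for n :: nat by auto
  have mono: "sets (\<sigma> {1..m}) \<subseteq> sets (\<sigma> {1..n})" if "m \<le> n" for m n
    using that by (intro sets_sigma_rv_mono) auto
  have "AE x in P. cexp {1..} S x = F x"
  proof (rule sigma_finite_subalgebra.real_cond_exp_charact[OF sigma_finite_subalgebra_sigma])
    fix A assume A: "A \<in> sets (\<sigma> {1..})"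
    have "sets (\<sigma> {1..}) \<subseteq> sigma_sets (space P) ?G"
      unfolding sets_sigma_rv[of P E X "{1..}"]
    proof (rule sigma_sets_mono, rule subsetI)
      fix a assume "a \<in> (\<Union>j\<in>{1..}. {X j -` B \<inter> space P | B. B \<in> sets (E j)})"
      then obtain j B where "j \<in> {1..}" "B \<in> sets (E j)" "a = X j -` B \<inter> space P" by blast
      then have "a \<in> sets (\<sigma> {1..j})"
        unfolding sets_sigma_rv by (intro sigma_sets.Basic UN_I[of j]) auto
      then show "a \<in> sigma_sets (space P) ?G" by (intro sigma_sets.Basic) blast
    qed
    with A have A: "A \<in> sigma_sets (space P) ?G" by blast
    show "(\<integral>x\<in>A. S x \<partial>P) = (\<integral>x\<in>A. F x \<partial>P)"
    proof (rule set_integral_eq_sigma_sets[OF _ _ _ _ _ _ A])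
      show "Int_stable ?G"
      proof (rule Int_stableI)
        fix a b assume "a \<in> ?G" "b \<in> ?G"
        then obtain m n where "a \<in> sets (\<sigma> {1..m})" "b \<in> sets (\<sigma> {1..n})" by blast
        then have "a \<in> sets (\<sigma> {1..max m n})" "b \<in> sets (\<sigma> {1..max m n})"
          using mono[of m "max m n"] mono[of n "max m n"] by auto
        then show "a \<inter> b \<in> ?G" by blast
      qed
      show "?G \<subseteq> sets P" using subalgebra_sigma[OF sub] by (auto simp: subalgebra_def)
      have "space P \<in> sets (\<sigma> {1..0})"
        using sets.top[of "\<sigma> {1..0}"] by (simp only: space_sigma_rv)
      then show "space P \<in> ?G" by blast
    next
      fix A assume "A \<in> ?G"
      then obtain m where m: "A \<in> sets (\<sigma> {1..m})" by blast
      then have "A \<in> sets P" using subalgebra_sigma[OF sub] by (auto simp: subalgebra_def)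
      then have A_L2: "indicat_real A \<in> L2 P"
        by (rule L2_indicator)
      \<comment> \<open>From \<open>n = m\<close> on, \<open>A\<close> belongs to
        \<open>\<sigma> {1..n}\<close>, so \<open>cexp {1..n} F\<close> and \<open>F\<close> have
        the same integral over \<open>A\<close>.\<close>
      have "L2_inner P S (indicat_real A) = L2_inner P F (indicat_real A)"
      proof (rule LIMSEQ_unique[OF cexp_lim[OF A_L2]])
        have "\<forall>\<^sub>F n in sequentially. L2_inner P (cexp {1..n} F) (indicat_real A) = L2_inner P F (indicat_real A)"
          using eventually_ge_at_top[of m]
        proof eventually_elim
          case (elim n)
          then have "A \<in> sets (\<sigma> {1..n})" using m mono by blast
          then have "indicat_real A \<in> borel_measurable (\<sigma> {1..n})" by simp
          from cexp_inner[OF sub F(1) A_L2 this] show ?case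
            by (simp add: L2_inner_commute[of P _ "indicat_real A"])
        qed
        then show "(\<lambda>n. L2_inner P (cexp {1..n} F) (indicat_real A)) \<longlonglongrightarrow> L2_inner P F (indicat_real A)"
          by (rule tendsto_eventually)
      qed
      then show "(\<integral>x\<in>A. S x \<partial>P) = (\<integral>x\<in>A. F x \<partial>P)"
        by (simp add: L2_inner_def set_lebesgue_integral_def mult.commute)
    qed (use S_L2 F in \<open>auto intro: L2_integrable\<close>)
  qed (use S_L2 F in \<open>auto intro: L2_integrable\<close>)
  \<comment> \<open>\<open>S\<close> is so far only known to be \<open>P\<close>-measurable; since
    \<open>F\<close> is \<open>\<sigma> {1..}\<close>-measurable, pairing with \<open>F\<close>
    removes the projection.\<close>
  then have "L2_inner P F F = L2_inner P F (cexp {1..} S)"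
    using F by (intro L2_inner_cong_AE) (auto dest: L2_measurable)
  also have "\<dots> = L2_inner P S F"
    using cexp_inner[OF subset_refl S_L2 F] by (simp add: L2_inner_commute)
  finally have "((\<lambda>M. L2_inner P (hcomp F M) F) has_sum L2_inner P F F) ?A"
    using L2_has_sum_imp_inner_has_sum[OF S F(1)] by simp
  then show ?thesis
    by (rule has_sum_cong[THEN iffD1, rotated]) (use F in \<open>auto simp: inner_hcomp_self\<close>)
qed

end

section \<open>The tuples that enumerate a given finite set\<close>

lemma increasing_tuples_fibre:
  assumes "finite M" "M \<subseteq> {1..}" "card M = p"
  shows "{js \<in> increasing_tuples p. set js = M} = {sorted_list_of_set M}"
proof -
  have "js = sorted_list_of_set M" if "sorted_wrt (<) js" "set js = M" for js
    using that assms(1) by (intro strict_sorted_equal) simp_all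
  then show ?thesis
    using assms by (auto simp: increasing_tuples_def)
qed

lemma distinct_tuples_fibre:
  assumes "M \<subseteq> {1..}" "card M = p"
  shows "{js \<in> distinct_tuples p. set js = M} = permutations_of_set M"
  using assms by (auto simp: distinct_tuples_def permutations_of_set_def distinct_card)

section \<open>Iterated differences and sums over levels and tuples\<close>

context independent_sequence
begin

lemma cexp_sum_cmult:
  assumes J: "J \<subseteq> {1..}" and f: "\<And>i. integrable P (f i)"
  shows "AE x in P. cexp J (\<lambda>x. \<Sum>i\<in>I. c i * f i x) x = (\<Sum>i\<in>I. c i * cexp J (f i) x)"
proof (cases "finite I")
  case True
  interpret J: finite_measure_subalgebra P "\<sigma> J" by (rule finite_measure_subalgebra_sigma[OF J])
  have "AE x in P. cexp J (\<lambda>x. \<Sum>i\<in>I. c i * f i x) x = (\<Sum>i\<in>I. cexp J (\<lambda>x. c i * f i x) x)"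
    using f by (intro J.real_cond_exp_sum) simp
  moreover have "AE x in P. \<forall>i\<in>I. cexp J (\<lambda>x. c i * f i x) x = c i * cexp J (f i) x"
    using True f by (intro AE_finite_allI J.real_cond_exp_cmult)
  ultimately show ?thesis by eventually_elim simp
next
  case False
  interpret J: finite_measure_subalgebra P "\<sigma> J" by (rule finite_measure_subalgebra_sigma[OF J])
  \<comment> \<open>For infinite \<open>I\<close> both sums are 0 by convention.\<close>
  show ?thesis using False J.real_cond_exp_F_meas[of "\<lambda>x. 0"] by simp
qed

lemma cexp_sum_cexp:
  assumes J: "J \<subseteq> {1..}" and I: "finite I" and K: "\<And>i. K i \<subseteq> {1..}" and F: "integrable P F"
  shows "AE x in P. cexp J (\<lambda>x. \<Sum>i\<in>I. c i * cexp (K i) F x) x = (\<Sum>i\<in>I. c i * cexp (J \<inter> K i) F x)"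
proof -
  have "AE x in P. \<forall>i\<in>I. cexp J (cexp (K i) F) x = cexp (J \<inter> K i) F x"
    using I by (rule AE_finite_allI) (rule cexp_cexp[OF J K F])
  moreover have "AE x in P. cexp J (\<lambda>x. \<Sum>i\<in>I. c i * cexp (K i) F x) x
      = (\<Sum>i\<in>I. c i * cexp J (cexp (K i) F) x)"
    by (intro cexp_sum_cmult J cexp_integrable K F)
  ultimately show ?thesis by eventually_elim simp
qed

text \<open>Applying \<open>D_op\<close> for a new index \<open>k\<close> keeps every term and adds
  its negative with \<open>k\<close> removed from the conditioning set. Membership in
  \<open>L2\<close> is part of the induction because \<open>cexp_L2\<close> and the measurability
  for \<open>cexp_cong\<close> rest on it.\<close>

lemma D_list_expansion:
  assumes F: "F \<in> L2 P" "F \<in> borel_measurable (\<sigma> {1..})"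
    and js: "distinct js" "set js \<subseteq> {1..}"
  shows "D_list P E X js F \<in> L2 P"
    and "AE x in P. D_list P E X js F x =
      (\<Sum>L\<in>Pow (set js). (-1) ^ card L * cexp ({1..} - L) F x)"
proof -
  note int = L2_integrable[OF F(1)]
  have "D_list P E X js F \<in> L2 P \<and> (AE x in P. D_list P E X js F x =
      (\<Sum>L\<in>Pow (set js). (-1) ^ card L * cexp ({1..} - L) F x))"
    using js
  proof (induction js)
    case Nil
    \<comment> \<open>The empty product is the identity, while the formula gives
      \<open>cexp {1..} F\<close>; here the measurability of \<open>F\<close> with respect to the
      whole sequence enters.\<close>
    have "AE x in P. F x = cexp {1..} F x"
      using cexp_top[OF int F(2)] by eventually_elim simp
    then show ?case using F(1) by (simp add: D_list_def)
  next
    case (Cons k js)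
    let ?G = "D_list P E X js F"
    let ?s = "\<lambda>x. \<Sum>L\<in>Pow (set js). (-1) ^ card L * cexp ({1..} - L) F x"
    let ?J = "{1..} - {k}"
    have G: "?G \<in> L2 P" "AE x in P. ?G x = ?s x" using Cons by auto
    have D: "D_list P E X (k # js) F x = ?G x - cexp ?J ?G x" for x
      by (simp add: D_list_def D_op_def)
    have J: "?J \<subseteq> {1..}" by auto
    have "AE x in P. cexp ?J ?G x = cexp ?J ?s x"
      using G L2_measurable[OF G(1)] by (intro cexp_cong[OF J]) auto
    moreover have "AE x in P. cexp ?J ?s x =
        (\<Sum>L\<in>Pow (set js). (-1) ^ card L * cexp (?J \<inter> ({1..} - L)) F x)"
      by (rule cexp_sum_cexp[OF J _ _ int]) auto
    ultimately have "AE x in P. D_list P E X (k # js) F x =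
        ?s x - (\<Sum>L\<in>Pow (set js). (-1) ^ card L * cexp (?J \<inter> ({1..} - L)) F x)"
      using G(2) by eventually_elim (simp add: D)
    moreover have "?s x - (\<Sum>L\<in>Pow (set js). (-1) ^ card L * cexp (?J \<inter> ({1..} - L)) F x) =
        (\<Sum>L\<in>Pow (set (k # js)). (-1) ^ card L * cexp ({1..} - L) F x)" for x
    proof -
      let ?h = "\<lambda>L. (-1) ^ card L * cexp ({1..} - L) F x"
      have k: "k \<notin> set js" using Cons by simp
      then have inj: "inj_on (insert k) (Pow (set js))" by (auto simp: inj_on_def)
      have "(\<Sum>L\<in>Pow (set (k # js)). ?h L) =
          (\<Sum>L\<in>Pow (set js). ?h L) + (\<Sum>L\<in>insert k ` Pow (set js). ?h L)"
        unfolding list.set Pow_insert using k by (intro sum.union_disjoint) auto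
      also have "(\<Sum>L\<in>insert k ` Pow (set js). ?h L) =
          (\<Sum>L\<in>Pow (set js). - ((-1) ^ card L * cexp (?J \<inter> ({1..} - L)) F x))"
        unfolding sum.reindex[OF inj]
      proof (rule sum.cong)
        fix L assume "L \<in> Pow (set js)"
        then have "finite L" "k \<notin> L" using k finite_subset[of L "set js"] by auto
        moreover have "{1..} - insert k L = ?J \<inter> ({1..} - L)" by auto
        ultimately show "(?h \<circ> insert k) L = - ((-1) ^ card L * cexp (?J \<inter> ({1..} - L)) F x)"
          by simp
      qed simp
      finally show ?thesis by (simp add: sum_negf)
    qed
    moreover have "D_list P E X (k # js) F \<in> L2 P"
      using L2_diff[OF G(1) cexp_L2[OF J G(1)]] unfolding D[abs_def] .
    ultimately show ?case by simp
  qed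
  then show "D_list P E X js F \<in> L2 P"
    and "AE x in P. D_list P E X js F x =
      (\<Sum>L\<in>Pow (set js). (-1) ^ card L * cexp ({1..} - L) F x)" by auto
qed

lemma hcomp_eq_cexp_D_list:
  assumes F: "F \<in> L2 P" "F \<in> borel_measurable (\<sigma> {1..})"
    and js: "distinct js" "set js \<subseteq> {1..}"
  shows "AE x in P. hcomp F (set js) x = cexp (set js) (D_list P E X js F) x"
proof -
  let ?M = "set js"
  let ?s = "\<lambda>x. \<Sum>L\<in>Pow ?M. (-1) ^ card L * cexp ({1..} - L) F x"
  have "AE x in P. cexp ?M (D_list P E X js F) x = cexp ?M ?s x"
    using D_list_expansion[OF F js] by (intro cexp_cong[OF js(2)]) (auto dest: L2_measurable)
  moreover have "AE x in P. cexp ?M ?s x = (\<Sum>L\<in>Pow ?M. (-1) ^ card L * cexp (?M \<inter> ({1..} - L)) F x)"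
    by (rule cexp_sum_cexp[OF js(2) _ _ L2_integrable[OF F(1)]]) auto
  ultimately have "AE x in P. cexp ?M (D_list P E X js F) x =
      (\<Sum>L\<in>Pow ?M. (-1) ^ card L * cexp (?M \<inter> ({1..} - L)) F x)"
    by eventually_elim simp
  moreover have "(\<Sum>L\<in>Pow ?M. (-1) ^ card L * cexp (?M \<inter> ({1..} - L)) F x) = hcomp F ?M x" for x
    unfolding hcomp_eq
  \<comment> \<open>Complementation in \<open>?M\<close> exchanges the removed indices with the
    conditioning indices and turns the sign exponent \<open>card L\<close> into that of
    \<open>hcomp\<close>.\<close>
  proof (rule sum.reindex_bij_witness[where i = "\<lambda>L. ?M - L" and j = "\<lambda>L. ?M - L"])
    fix L assume L: "L \<in> Pow ?M"
    then have "card ?M - card (?M - L) = card L"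
      by (simp add: card_Diff_subset finite_subset card_mono)
    moreover have "?M \<inter> ({1..} - L) = ?M - L" using js(2) by auto
    ultimately show "(-1) ^ (card ?M - card (?M - L)) * cexp (?M - L) F x =
        (-1) ^ card L * cexp (?M \<inter> ({1..} - L)) F x"
      by simp
  qed auto
  ultimately show ?thesis by (simp add: eq_commute)
qed

text \<open>The level sums are pairwise orthogonal and each has the same inner product with
  \<open>F\<close> as with itself. Hence the squared distance from \<open>F\<close> to a partial sum
  is a tail of Parseval's series grouped by cardinality.\<close>

lemma hcomp_level_sums:
  assumes F: "F \<in> L2 P" "F \<in> borel_measurable (\<sigma> {1..})"
  obtains S where
    "\<And>p. L2_has_sum P (hcomp F) {M. finite M \<and> M \<subseteq> {1..} \<and> card M = p} (S p)"
    "L2_tendsto P (\<lambda>n x. expectation F + (\<Sum>p = 1..n. S p x)) F sequentially"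
proof -
  let ?A = "{M :: nat set. finite M \<and> M \<subseteq> {1..}}"
  let ?L = "\<lambda>p. {M :: nat set. finite M \<and> M \<subseteq> {1..} \<and> card M = p}"
  \<comment> \<open>An \<open>L2\<close> sum is determined only up to null sets. At level 0 the
    constant representative is fixed, so that the \<open>p = 0\<close> term can later be split off
    pointwise.\<close>
  have "\<exists>S. L2_has_sum P (hcomp F) (?L p) S \<and> (p = 0 \<longrightarrow> S = (\<lambda>x. expectation F))" for p
  proof (cases "p = 0")
    case True
    have L: "?L 0 = {{}}" by (auto simp: card_eq_0_iff)
    have const: "(\<lambda>x. expectation F) \<in> L2 P" by (simp add: L2_def)
    have "AE x in P. hcomp F {} x = expectation F"
      using cexp_empty[OF L2_integrable[OF F(1)]] by (simp add: hcomp_eq)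
    then have "L2_inner P (hcomp F {}) (hcomp F {}) = L2_inner P (\<lambda>x. expectation F) (\<lambda>x. expectation F)"
      "L2_inner P (hcomp F {}) (hcomp F {}) = L2_inner P (\<lambda>x. expectation F) (hcomp F {})"
      using hcomp_L2[of "{}", OF _ F(1), THEN L2_measurable] by (auto intro!: L2_inner_cong_AE)
    then have "L2_has_sum P (hcomp F) {{}} (\<lambda>x. expectation F)"
      using const F(1) by (intro L2_orthogonal_has_sumI has_sum_finiteI) (auto intro: hcomp_L2)
    then show ?thesis unfolding True L by blast
  next
    case False
    have "?L p \<subseteq> ?A" by auto
    from hcomp_summable[OF this F(1)] show ?thesis using False by blast
  qed
  then obtain S where S: "\<And>p. L2_has_sum P (hcomp F) (?L p) (S p)"
    and S0: "S 0 = (\<lambda>x. expectation F)" by metis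
  have S_L2: "S p \<in> L2 P" for p using S[of p] by (simp add: L2_has_sum_def L2_tendsto_def)
  have orth: "L2_inner P (hcomp F M) (hcomp F N) = 0"
    if "M \<in> ?L p" "N \<in> ?L q" "M \<noteq> N" for M N p q
    using that F(1) by (intro hcomp_orthogonal) auto
  have norm_S: "((\<lambda>M. L2_inner P (hcomp F M) (hcomp F M)) has_sum L2_inner P (S p) (S p)) (?L p)" for p
    by (rule L2_has_sum_orthogonal(2)[OF S orth])
  have inner_SF: "L2_inner P (S p) F = L2_inner P (S p) (S p)" for p
  proof (rule has_sum_unique[OF _ norm_S])
    show "((\<lambda>M. L2_inner P (hcomp F M) (hcomp F M)) has_sum L2_inner P (S p) F) (?L p)"
      by (rule has_sum_cong[THEN iffD1, OF _ L2_has_sum_imp_inner_has_sum[OF S F(1)]])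
         (use F(1) in \<open>blast intro: inner_hcomp_self\<close>)
  qed
  have inner_SS: "L2_inner P (S p) (S q) = 0" if "p \<noteq> q" for p q
  proof -
    have "L2_inner P (S q) (hcomp F M) = 0" if M: "M \<in> ?L p" for M
    proof (rule has_sum_unique)
      show "((\<lambda>N. L2_inner P (hcomp F N) (hcomp F M)) has_sum L2_inner P (S q) (hcomp F M)) (?L q)"
        using M F by (intro L2_has_sum_imp_inner_has_sum[OF S] hcomp_L2) auto
      have "L2_inner P (hcomp F N) (hcomp F M) = 0" if "N \<in> ?L q" for N
        using that M \<open>p \<noteq> q\<close> by (intro orth) auto
      then show "((\<lambda>N. L2_inner P (hcomp F N) (hcomp F M)) has_sum 0) (?L q)"
        by (rule has_sum_0)
    qed
    then have "((\<lambda>M. L2_inner P (hcomp F M) (S q)) has_sum 0) (?L p)"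
      by (intro has_sum_0) (simp add: L2_inner_commute[of P _ "S q"])
    then show ?thesis
      using has_sum_unique L2_has_sum_imp_inner_has_sum[OF S S_L2] by blast
  qed
  have "((\<lambda>p. L2_inner P (S p) (S p)) has_sum L2_inner P F F) UNIV"
  proof (rule has_sum_Sigma')
    show "(((\<lambda>M. L2_inner P (hcomp F M) (hcomp F M)) \<circ> snd) has_sum L2_inner P F F) (SIGMA p:UNIV. ?L p)"
    proof -
      have "bij_betw (\<lambda>M. (card M, M)) ?A (SIGMA p:UNIV. ?L p)"
        by (intro bij_betw_byWitness[where f' = snd]) auto
      from has_sum_reindex_bij_betw[OF this, of "(\<lambda>M. L2_inner P (hcomp F M) (hcomp F M)) \<circ> snd"]
      show ?thesis using hcomp_Parseval[OF F] by simp
    qed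
  qed (use norm_S in simp)
  then have Parseval: "(\<lambda>p. L2_inner P (S p) (S p)) sums L2_inner P F F"
    by (rule has_sum_imp_sums)
  let ?R = "\<lambda>n x. \<Sum>p\<le>n. S p x"
  have R_L2: "?R n \<in> L2 P" for n by (intro L2_sum S_L2)
  have "L2_inner P (\<lambda>x. ?R n x - F x) (\<lambda>x. ?R n x - F x) =
      L2_inner P F F - (\<Sum>p\<le>n. L2_inner P (S p) (S p))" for n
  proof -
    have "L2_inner P (?R n) (?R n) = (\<Sum>p\<le>n. \<Sum>q\<le>n. L2_inner P (S p) (S q))"
      using S_L2 R_L2 by (simp add: L2_inner_sum_left L2_inner_sum_right)
    also have "\<dots> = (\<Sum>p\<le>n. \<Sum>q\<le>n. if q = p then L2_inner P (S p) (S p) else 0)"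
      using inner_SS by (intro sum.cong) auto
    also have "\<dots> = (\<Sum>p\<le>n. L2_inner P (S p) (S p))" by simp
    finally have "L2_inner P (?R n) (?R n) = (\<Sum>p\<le>n. L2_inner P (S p) (S p))" .
    moreover have "L2_inner P (?R n) F = (\<Sum>p\<le>n. L2_inner P (S p) (S p))"
      using S_L2 F by (simp add: L2_inner_sum_left inner_SF)
    ultimately show ?thesis using L2_inner_diff_self[OF R_L2 F(1), of n] by simp
  qed
  moreover have "(\<lambda>n. L2_inner P F F - (\<Sum>p\<le>n. L2_inner P (S p) (S p))) \<longlonglongrightarrow> L2_inner P F F - L2_inner P F F"
    using Parseval unfolding sums_def_le by (intro tendsto_intros)
  ultimately have "(\<lambda>n. L2norm P (\<lambda>x. ?R n x - F x)) \<longlonglongrightarrow> 0"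
    by (intro L2norm_tendsto_zeroI) simp
  then have "L2_tendsto P ?R F sequentially"
    using R_L2 F(1) by (simp add: L2_tendsto_def)
  moreover have "?R n x = expectation F + (\<Sum>p = 1..n. S p x)" for n x
    using S0 by (simp add: atMost_atLeast0 sum.atLeast_Suc_atMost)
  ultimately have "L2_tendsto P (\<lambda>n x. expectation F + (\<Sum>p = 1..n. S p x)) F sequentially"
    by simp
  with S show thesis by (rule that)
qed

text \<open>\<open>c\<close> counts the enumerations in \<open>J\<close> of a set with
  \<open>p\<close> elements: 1 for increasing tuples, \<open>fact p\<close> for distinct
  ones.\<close>

lemma tuples_has_sum:
  assumes F: "F \<in> L2 P" "F \<in> borel_measurable (\<sigma> {1..})"
    and S: "L2_has_sum P (hcomp F) {M. finite M \<and> M \<subseteq> {1..} \<and> card M = p} S"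
    and J: "\<And>js. js \<in> J \<Longrightarrow> distinct js \<and> set js \<subseteq> {1..} \<and> length js = p"
    and fibres: "\<And>M. finite M \<Longrightarrow> M \<subseteq> {1..} \<Longrightarrow> card M = p \<Longrightarrow>
      finite {js \<in> J. set js = M} \<and> card {js \<in> J. set js = M} = c"
  shows "L2_has_sum P (\<lambda>js. cexp (set js) (D_list P E X js F)) J (\<lambda>x. real c * S x)"
proof (rule L2_has_sum_fibres[OF S, where \<pi> = set])
  show "set ` J \<subseteq> {M. finite M \<and> M \<subseteq> {1..} \<and> card M = p}"
    using J distinct_card by blast
  show "AE x in P. hcomp F (set js) x = cexp (set js) (D_list P E X js F) x" if "js \<in> J" for js
    using J[OF that] by (intro hcomp_eq_cexp_D_list[OF F]) auto
qed (use F fibres in \<open>auto intro!: hcomp_orthogonal\<close>)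

end

theorem corollary2p4:
  fixes P :: "'a measure"
    and E :: "nat \<Rightarrow> 'b measure"
    and X :: "nat \<Rightarrow> 'a \<Rightarrow> 'b"
    and F :: "'a \<Rightarrow> real"
  assumes "prob_space P"
    and "\<And>n. n \<in> {1..} \<Longrightarrow> prob_space (E n)"
    and "prob_space.indep_vars P E X {1..}"
    and "\<And>n. n \<in> {1..} \<Longrightarrow> distr P (E n) (X n) = E n"
    and "F \<in> L2_X P E X"
  shows "(\<forall>M js. finite M \<and> M \<subseteq> {1..} \<and> distinct js \<and> set js = M \<longrightarrow>
            (AE \<omega> in P. hoeffding_comp P E X F M \<omega> =
               real_cond_exp P (sigma_rv P E X M) (D_list P E X js F) \<omega>))
       \<and> (\<exists>S :: nat \<Rightarrow> 'a \<Rightarrow> real.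
            (\<forall>p\<ge>1. L2_has_sum P
               (\<lambda>js. real_cond_exp P (sigma_rv P E X (set js)) (D_list P E X js F))
               (increasing_tuples p) (S p)) \<and>
            L2_tendsto P
              (\<lambda>n \<omega>. integral\<^sup>L P F + (\<Sum>p = 1..n. S p \<omega>)) F sequentially)
       \<and> (\<exists>T :: nat \<Rightarrow> 'a \<Rightarrow> real.
            (\<forall>p\<ge>1. L2_has_sum P
               (\<lambda>js. real_cond_exp P (sigma_rv P E X (set js)) (D_list P E X js F))
               (distinct_tuples p) (T p)) \<and>
            L2_tendsto P
              (\<lambda>n \<omega>. integral\<^sup>L P F + (\<Sum>p = 1..n. 1 / fact p * T p \<omega>)) F sequentially)"
proof -
  interpret prob_space P by fact
  interpret independent_sequence P E X
    by unfold_locales fact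
  have sub: "subalgebra P (\<sigma> {1..})" by (rule subalgebra_sigma) simp
  have meas: "F \<in> borel_measurable (\<sigma> {1..})"
    using assms(5) measurable_in_subalg'[OF sub] by (auto simp: L2_X_def L2_def)
  have L2: "F \<in> L2 P"
    using assms(5) measurable_from_subalg[OF sub meas] integrable_from_subalg[OF sub]
    by (auto simp: L2_X_def L2_def)
  obtain S where S: "\<And>p. L2_has_sum P (hcomp F) {M. finite M \<and> M \<subseteq> {1..} \<and> card M = p} (S p)"
    and lim: "L2_tendsto P (\<lambda>n x. expectation F + (\<Sum>p = 1..n. S p x)) F sequentially"
    using hcomp_level_sums[OF L2 meas] by blast
  have "L2_has_sum P (\<lambda>js. cexp (set js) (D_list P E X js F)) (increasing_tuples p)
      (\<lambda>x. real 1 * S p x)" for p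
  proof (rule tuples_has_sum[OF L2 meas S])
    show "distinct js \<and> set js \<subseteq> {1..} \<and> length js = p" if "js \<in> increasing_tuples p" for js
      using that by (auto simp: increasing_tuples_def strict_sorted_iff)
  qed (simp add: increasing_tuples_fibre)
  then have incr: "L2_has_sum P (\<lambda>js. cexp (set js) (D_list P E X js F)) (increasing_tuples p) (S p)" for p
    by simp
  have dist: "L2_has_sum P (\<lambda>js. cexp (set js) (D_list P E X js F)) (distinct_tuples p)
      (\<lambda>x. real (fact p) * S p x)" for p
  proof (rule tuples_has_sum[OF L2 meas S])
    show "distinct js \<and> set js \<subseteq> {1..} \<and> length js = p" if "js \<in> distinct_tuples p" for js
      using that by (auto simp: distinct_tuples_def)
  qed (simp add: distinct_tuples_fibre card_permutations_of_set)
  show ?thesis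
  proof (intro conjI exI)
    show "\<forall>M js. finite M \<and> M \<subseteq> {1..} \<and> distinct js \<and> set js = M \<longrightarrow>
            (AE \<omega> in P. hcomp F M \<omega> = cexp M (D_list P E X js F) \<omega>)"
      using hcomp_eq_cexp_D_list[OF L2 meas] by blast
    \<comment> \<open>The sum over distinct tuples is \<open>fact p\<close> times
      \<open>S p\<close>; the prefactor cancels and \<open>lim\<close> applies.\<close>
    show "L2_tendsto P (\<lambda>n \<omega>. expectation F + (\<Sum>p = 1..n. 1 / fact p * (real (fact p) * S p \<omega>)))
        F sequentially"
      using lim by simp
  qed (use incr dist lim in auto)
qed

end
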